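(* Assume that $E=I_n+BK_DC$ is nonsingular, that $A_{\rm id}$ is Hurwitz, and that $M_D=CBK_D$ has no eigenvalue on the unit circle $\{z\in\mathbb C:|z|=1\}$. Then the sampled PID implementation based on the backward difference is exponentially stable for every sufficiently small sampling period (that is, there exists $h^\star>0$ such that it is exponentially stable for every $h\in(0,h^\star)$) if and only if $\rho(M_D)<1$. Moreover, if $E=I_n+BK_DC$ is nonsingular, $A_{\rm id}$ is Hurwitz, $M_D=CBK_D$ has no eigenvalue on the unit circle $\{z\in\mathbb C:|z|=1\}$, and $\rho(M_D)>1$, then no sufficiently small sampling period can recover stability: there exists $h_0>0$ such that for every $h\in(0,h_0)$ the sampled implementation is not exponentially stable.
   Context: Fix positive integers $n,m,p$ and real matrices $A\in\mathbb R^{n\times n}$, $B\in\mathbb R^{n\times m}$, $C\in\mathbb R^{p\times n}$ (the plant $\dot x=Ax+Bu$, $y=Cx$) and gains $K_P,K_I,K_D\in\mathbb R^{m\times p}$. Set $E=I_n+BK_DC$ and $M_D=CBK_D\in\mathbb R^{p\times p}$. When $E$ is nonsingular, the ideal PID closed-loop matrix is $$A_{\rm id}=\begin{bmatrix}E^{-1}(A-BK_PC)&-E^{-1}BK_I\\ C&0\end{bmatrix}\in\mathbb R^{(n+p)\times(n+p)}.$$ A square matrix is called Hurwitz if all its eigenvalues (in $\mathbb C$) have negative real parts; $\rho(\cdot)$ denotes the spectral radius. Sampled PID implementation with sampling period $h>0$: with $\Phi_h=e^{Ah}$ and $\Gamma_h=\int_0^h e^{A\tau}\,d\tau$, the state is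 $\chi_k=(x_k,z_k,r_k)\in\mathbb R^{n}\times\mathbb R^p\times\mathbb R^p$ and the updates are $$u_k=-K_PCx_k-K_Iz_k-K_D\frac{Cx_k-r_k}{h},\quad x_{k+1}=\Phi_hx_k+\Gamma_hBu_k,\quad z_{k+1}=z_k+hCx_k,\quad r_{k+1}=Cx_k,$$ that is, $\chi_{k+1}=\mathcal A_h\chi_k$ with $$\mathcal A_h=\begin{bmatrix}\Phi_h-\Gamma_hB(K_P+h^{-1}K_D)C&-\Gamma_hBK_I&h^{-1}\Gamma_hBK_D\\ hC&I_p&0\\ C&0&0\end{bmatrix}.$$ The sampled implementation is exponentially stable if this linear discrete-time system is exponentially stable for every initial triple $(x_0,z_0,r_0)$; equivalently, if all eigenvalues of $\mathcal A_h$ lie in the open unit disk. *)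

theory Defs
  imports "HOL-Analysis.Analysis" "Jordan_Normal_Form.Spectral_Radius"
    "Jordan_Normal_Form.Gauss_Jordan_Elimination"
begin

definition cmat :: "real mat \<Rightarrow> complex mat" where
  "cmat M = map_mat complex_of_real M"

definition hurwitz :: "real mat \<Rightarrow> bool" where
  "hurwitz M \<longleftrightarrow> (\<forall>\<mu>. eigenvalue (cmat M) \<mu> \<longrightarrow> Re \<mu> < 0)"

definition mat_exp :: "real mat \<Rightarrow> real mat" where
  "mat_exp A = mat (dim_row A) (dim_row A) (\<lambda>(i,j). \<Sum>k. (A ^\<^sub>m k) $$ (i,j) / fact k)"

text \<open>\<open>Phi A h\<close> is $e^{Ah}$, and \<open>Gam A h\<close> is the entrywise integral of $e^{A\tau}$
  over $[0,h]$.\<close>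

definition Phi :: "real mat \<Rightarrow> real \<Rightarrow> real mat" where
  "Phi A h = mat_exp (h \<cdot>\<^sub>m A)"

definition Gam :: "real mat \<Rightarrow> real \<Rightarrow> real mat" where
  "Gam A h = mat (dim_row A) (dim_row A) (\<lambda>(i,j). integral {0..h} (\<lambda>\<tau>. Phi A \<tau> $$ (i,j)))"

text \<open>Only meaningful when $E = I_n + B K_D C$ is nonsingular; otherwise
  \<^const>\<open>mat_inverse\<close> returns \<^const>\<open>None\<close>.\<close>

definition ideal_pid_matrix ::
  "real mat \<Rightarrow> real mat \<Rightarrow> real mat \<Rightarrow> real mat \<Rightarrow> real mat \<Rightarrow> real mat \<Rightarrow> real mat" where
  "ideal_pid_matrix A B C KP KI KD =
     (let n = dim_row A; p = dim_row C;
          Einv = the (mat_inverse (1\<^sub>m n + B * KD * C))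
      in four_block_mat
           (Einv * (A - B * KP * C)) (- (Einv * B * KI))
           C                         (0\<^sub>m p p))"

text \<open>The 3-by-3 block matrix acting on $(x,z,r)$, arranged as a 2-by-2 block matrix whose
  second row and column of blocks collect the components $z$ and $r$.\<close>

definition sampled_pid_matrix ::
  "real mat \<Rightarrow> real mat \<Rightarrow> real mat \<Rightarrow> real mat \<Rightarrow> real mat \<Rightarrow> real mat \<Rightarrow> real \<Rightarrow> real mat" where
  "sampled_pid_matrix A B C KP KI KD h =
     (let p = dim_row C; G = Gam A h
      in four_block_mat
           (Phi A h - G * B * (KP + (1 / h) \<cdot>\<^sub>m KD) * C)
           (four_block_mat (- (G * B * KI)) ((1 / h) \<cdot>\<^sub>m (G * B * KD)) (0\<^sub>m 0 p) (0\<^sub>m 0 p))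
           ((h \<cdot>\<^sub>m C) @\<^sub>r C)
           (four_block_mat (1\<^sub>m p) (0\<^sub>m p p) (0\<^sub>m p p) (0\<^sub>m p p)))"

definition vec_enorm :: "real vec \<Rightarrow> real" where
  "vec_enorm v = sqrt (scalar_prod v v)"

definition dt_exponentially_stable :: "real mat \<Rightarrow> bool" where
  "dt_exponentially_stable M \<longleftrightarrow>
     (\<exists>c \<gamma>. c > 0 \<and> 0 < \<gamma> \<and> \<gamma> < 1 \<and>
        (\<forall>s :: nat \<Rightarrow> real vec.
           s 0 \<in> carrier_vec (dim_row M) \<and> (\<forall>k. s (Suc k) = M *\<^sub>v s k) \<longrightarrow>
           (\<forall>k. vec_enorm (s k) \<le> c * \<gamma> ^ k * vec_enorm (s 0))))"

definition sampled_pid_stable ::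
  "real mat \<Rightarrow> real mat \<Rightarrow> real mat \<Rightarrow> real mat \<Rightarrow> real mat \<Rightarrow> real mat \<Rightarrow> real \<Rightarrow> bool" where
  "sampled_pid_stable A B C KP KI KD h \<longleftrightarrow>
     dt_exponentially_stable (sampled_pid_matrix A B C KP KI KD h)"

text \<open>The block matrix implements the sampled control law and the state updates.\<close>

lemma sampled_pid_matrix_update:
  assumes A: "A \<in> carrier_mat n n" and B: "B \<in> carrier_mat n m" and C: "C \<in> carrier_mat p n"
    and KP: "KP \<in> carrier_mat m p" and KI: "KI \<in> carrier_mat m p" and KD: "KD \<in> carrier_mat m p"
    and x: "x \<in> carrier_vec n" and z: "z \<in> carrier_vec p" and r: "r \<in> carrier_vec p"
    and u: "u = - (KP *\<^sub>v (C *\<^sub>v x)) - KI *\<^sub>v z - KD *\<^sub>v ((1 / h) \<cdot>\<^sub>v (C *\<^sub>v x - r))"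
  shows "sampled_pid_matrix A B C KP KI KD h *\<^sub>v (x @\<^sub>v (z @\<^sub>v r)) =
     (Phi A h *\<^sub>v x + Gam A h *\<^sub>v (B *\<^sub>v u)) @\<^sub>v ((z + h \<cdot>\<^sub>v (C *\<^sub>v x)) @\<^sub>v (C *\<^sub>v x))"
proof -
  let ?G = "Gam A h" and ?y = "C *\<^sub>v x"
  let ?K = "KP + (1 / h) \<cdot>\<^sub>m KD"
  have P: "Phi A h \<in> carrier_mat n n" and G: "?G \<in> carrier_mat n n"
    using A by (auto simp: Phi_def Gam_def mat_exp_def)
  have GB: "?G * B \<in> carrier_mat n m" using G B by simp
  have y: "?y \<in> carrier_vec p" using C x by simp
  have K: "?K \<in> carrier_mat m p" using KP KD by simp
  have dims: "dim_row C = p" using C by simp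
  let ?X = "Phi A h - ?G * B * ?K * C"
  let ?Y = "four_block_mat (- (?G * B * KI)) ((1 / h) \<cdot>\<^sub>m (?G * B * KD)) (0\<^sub>m 0 p) (0\<^sub>m 0 p)"
  let ?Z = "(h \<cdot>\<^sub>m C) @\<^sub>r C"
  let ?W = "four_block_mat (1\<^sub>m p) (0\<^sub>m p p) (0\<^sub>m p p) (0\<^sub>m p p) :: real mat"
  have X: "?X \<in> carrier_mat n n" using P GB K C by (auto intro!: minus_carrier_mat)
  have Y: "?Y \<in> carrier_mat n (p + p)"
    using four_block_carrier_mat[of "- (?G * B * KI)" n p "0\<^sub>m 0 p" 0 p] GB KI by simp
  have Z: "?Z \<in> carrier_mat (p + p) n" using C by simp
  have W: "?W \<in> carrier_mat (p + p) (p + p)" by simp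
  have zr: "z @\<^sub>v r \<in> carrier_vec (p + p)" using z r by simp
  have smv: "(c \<cdot>\<^sub>m M) *\<^sub>v w = c \<cdot>\<^sub>v (M *\<^sub>v w)"
    if "M \<in> carrier_mat k l" "w \<in> carrier_vec l" for M :: "real mat" and w c k l
    by (rule eq_vecI) (use that in \<open>auto simp: smult_scalar_prod_distrib[of _ l]\<close>)
  have app0: "a @\<^sub>v b = a" if "dim_vec b = 0" for a b :: "real vec"
    by (rule eq_vecI) (use that in auto)
  have GBK: "(?G * B * L) *\<^sub>v w = ?G *\<^sub>v (B *\<^sub>v (L *\<^sub>v w))"
    if L: "L \<in> carrier_mat m p" and w: "w \<in> carrier_vec p" for L w
  proof -
    have "(?G * B * L) *\<^sub>v w = (?G * B) *\<^sub>v (L *\<^sub>v w)" by (rule assoc_mult_mat_vec[OF GB L w])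
    also have "\<dots> = ?G *\<^sub>v (B *\<^sub>v (L *\<^sub>v w))"
      by (rule assoc_mult_mat_vec[OF G B mult_mat_vec_carrier[OF L w]])
    finally show ?thesis .
  qed
  have Xx: "?X *\<^sub>v x = Phi A h *\<^sub>v x - ?G *\<^sub>v (B *\<^sub>v (?K *\<^sub>v ?y))"
  proof -
    have "?X *\<^sub>v x = Phi A h *\<^sub>v x - (?G * B * ?K * C) *\<^sub>v x"
      by (rule minus_mult_distrib_mat_vec[OF P _ x]) (use GB K C in simp)
    also have "(?G * B * ?K * C) *\<^sub>v x = ?G *\<^sub>v (B *\<^sub>v (?K *\<^sub>v ?y))"
    proof -
      have "(?G * B * ?K * C) *\<^sub>v x = (?G * B * ?K) *\<^sub>v ?y"
        by (rule assoc_mult_mat_vec[OF mult_carrier_mat[OF GB K] C x])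
      also have "\<dots> = ?G *\<^sub>v (B *\<^sub>v (?K *\<^sub>v ?y))" by (rule GBK[OF K y])
      finally show ?thesis .
    qed
    finally show ?thesis .
  qed
  have Yzr: "?Y *\<^sub>v (z @\<^sub>v r)
      = - (?G *\<^sub>v (B *\<^sub>v (KI *\<^sub>v z))) + (1 / h) \<cdot>\<^sub>v (?G *\<^sub>v (B *\<^sub>v (KD *\<^sub>v r)))"
  proof -
    have "?Y *\<^sub>v (z @\<^sub>v r)
      = (- (?G * B * KI) *\<^sub>v z + ((1 / h) \<cdot>\<^sub>m (?G * B * KD)) *\<^sub>v r) @\<^sub>v (0\<^sub>m 0 p *\<^sub>v z + 0\<^sub>m 0 p *\<^sub>v r)"
      by (rule four_block_mat_mult_vec[of _ n p _ p _ 0]) (use GB KI KD z r in auto)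
    also have "\<dots> = - (?G * B * KI) *\<^sub>v z + ((1 / h) \<cdot>\<^sub>m (?G * B * KD)) *\<^sub>v r"
      by (rule app0) simp
    also have "- (?G * B * KI) *\<^sub>v z = - (?G *\<^sub>v (B *\<^sub>v (KI *\<^sub>v z)))"
    proof -
      have "- (?G * B * KI) *\<^sub>v z = - ((?G * B * KI) *\<^sub>v z)"
        by (rule uminus_mult_mat_vec) (use KI z in simp)
      then show ?thesis unfolding GBK[OF KI z] .
    qed
    also have "((1 / h) \<cdot>\<^sub>m (?G * B * KD)) *\<^sub>v r = (1 / h) \<cdot>\<^sub>v (?G *\<^sub>v (B *\<^sub>v (KD *\<^sub>v r)))"
      unfolding smv[OF mult_carrier_mat[OF GB KD] r] GBK[OF KD r] ..
    finally show ?thesis .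
  qed
  have "sampled_pid_matrix A B C KP KI KD h *\<^sub>v (x @\<^sub>v (z @\<^sub>v r))
     = (?X *\<^sub>v x + ?Y *\<^sub>v (z @\<^sub>v r)) @\<^sub>v (?Z *\<^sub>v x + ?W *\<^sub>v (z @\<^sub>v r))"
    unfolding sampled_pid_matrix_def Let_def dims
    by (rule four_block_mat_mult_vec[OF X Y Z W x zr])
  also have "?X *\<^sub>v x + ?Y *\<^sub>v (z @\<^sub>v r) = Phi A h *\<^sub>v x + ?G *\<^sub>v (B *\<^sub>v u)"
  proof -
    have Ku: "u = - (?K *\<^sub>v ?y) + (- (KI *\<^sub>v z)) + (1 / h) \<cdot>\<^sub>v (KD *\<^sub>v r)"
    proof -
      have 1: "KD *\<^sub>v ((1 / h) \<cdot>\<^sub>v (?y - r)) = (1 / h) \<cdot>\<^sub>v (KD *\<^sub>v ?y - KD *\<^sub>v r)"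
        unfolding mult_mat_vec[OF KD minus_carrier_vec[OF y r]]
          mult_minus_distrib_mat_vec[OF KD y r] ..
      have sKD: "(1 / h) \<cdot>\<^sub>m KD \<in> carrier_mat m p" using KD by simp
      have 2: "?K *\<^sub>v ?y = KP *\<^sub>v ?y + (1 / h) \<cdot>\<^sub>v (KD *\<^sub>v ?y)"
        unfolding add_mult_distrib_mat_vec[OF KP sKD y] smv[OF KD y] ..
      have v: "KP *\<^sub>v ?y \<in> carrier_vec m" "KI *\<^sub>v z \<in> carrier_vec m"
        "KD *\<^sub>v ?y \<in> carrier_vec m" "KD *\<^sub>v r \<in> carrier_vec m"
        using KP KI KD y z r by auto
      have alg: "- a - b - c \<cdot>\<^sub>v (d - e) = - (a + c \<cdot>\<^sub>v d) + (- b) + c \<cdot>\<^sub>v e"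
        if "a \<in> carrier_vec m" "b \<in> carrier_vec m" "d \<in> carrier_vec m" "e \<in> carrier_vec m"
        for a b d e :: "real vec" and c
        by (rule eq_vecI) (use that in \<open>auto simp: algebra_simps\<close>)
      show ?thesis unfolding u 1 2 by (rule alg[OF v])
    qed
    have lin: "M *\<^sub>v (- a + (- b) + c \<cdot>\<^sub>v d) = - (M *\<^sub>v a) + (- (M *\<^sub>v b)) + c \<cdot>\<^sub>v (M *\<^sub>v d)"
      if "M \<in> carrier_mat k l" "a \<in> carrier_vec l" "b \<in> carrier_vec l" "d \<in> carrier_vec l"
      for M :: "real mat" and a b c d k l
    proof -
      have "M *\<^sub>v (- a) = - (M *\<^sub>v a)" "M *\<^sub>v (- b) = - (M *\<^sub>v b)"
        by (rule eq_vecI; use that in auto)+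
      moreover have "M *\<^sub>v (- a + (- b) + c \<cdot>\<^sub>v d) = M *\<^sub>v (- a) + M *\<^sub>v (- b) + M *\<^sub>v (c \<cdot>\<^sub>v d)"
        using that
        by (subst mult_add_distrib_mat_vec[OF that(1)], simp, simp,
            subst mult_add_distrib_mat_vec[OF that(1)]) auto
      ultimately show ?thesis using mult_mat_vec[OF that(1,4)] by simp
    qed
    have kc: "?K *\<^sub>v ?y \<in> carrier_vec m" "KI *\<^sub>v z \<in> carrier_vec m" "KD *\<^sub>v r \<in> carrier_vec m"
      by (rule mult_mat_vec_carrier[OF K y] mult_mat_vec_carrier[OF KI z]
          mult_mat_vec_carrier[OF KD r])+
    have bc: "B *\<^sub>v (?K *\<^sub>v ?y) \<in> carrier_vec n" "B *\<^sub>v (KI *\<^sub>v z) \<in> carrier_vec n"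
      "B *\<^sub>v (KD *\<^sub>v r) \<in> carrier_vec n"
      by (rule mult_mat_vec_carrier[OF B] kc)+
    have gc: "?G *\<^sub>v (B *\<^sub>v (?K *\<^sub>v ?y)) \<in> carrier_vec n" "?G *\<^sub>v (B *\<^sub>v (KI *\<^sub>v z)) \<in> carrier_vec n"
      "?G *\<^sub>v (B *\<^sub>v (KD *\<^sub>v r)) \<in> carrier_vec n" "Phi A h *\<^sub>v x \<in> carrier_vec n"
      by (rule mult_mat_vec_carrier[OF G] mult_mat_vec_carrier[OF P x] bc)+
    have alg: "f - a + (- b + c \<cdot>\<^sub>v d) = f + (- a + (- b) + c \<cdot>\<^sub>v d)"
      if "a \<in> carrier_vec n" "b \<in> carrier_vec n" "d \<in> carrier_vec n" "f \<in> carrier_vec n"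
      for a b d f :: "real vec" and c
      by (rule eq_vecI) (use that in auto)
    show ?thesis
      unfolding Xx Yzr Ku lin[OF B kc] lin[OF G bc] by (rule alg[OF gc])
  qed
  also have "?Z *\<^sub>v x + ?W *\<^sub>v (z @\<^sub>v r) = (z + h \<cdot>\<^sub>v ?y) @\<^sub>v ?y"
  proof -
    have "?Z *\<^sub>v x = (h \<cdot>\<^sub>v ?y) @\<^sub>v ?y"
      using mat_mult_append[OF _ C x, of "h \<cdot>\<^sub>m C" p] C smv[OF C x] by simp
    moreover have "?W *\<^sub>v (z @\<^sub>v r) = z @\<^sub>v 0\<^sub>v p"
      using four_block_mat_mult_vec[of "1\<^sub>m p" p p "0\<^sub>m p p" p "0\<^sub>m p p" p "0\<^sub>m p p" z r] z r
      by auto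
    ultimately show ?thesis
      by (intro eq_vecI) (use C z in auto)
  qed
  finally show ?thesis .
qed

end

theory Submission
  imports Defs
begin

text \<open>Write $d_k = (Cx_k - r_k)/h$ for the difference quotient that the controller uses. In the
  coordinates $(x, z, d)$ one sampling step reads $x^+ = x + hF$, $z^+ = z + hCx$, $d^+ = CF$, where
  $F = D_h x + G_h B u$, $u = -K_P C x - K_I z - K_D d$, $D_h = (\Phi_h - I)/h \to A$ and
  $G_h = \Gamma_h/h \to I$. So $(x, z)$ moves slowly, like an Euler step of size $h$, while $d$ is
  updated at once. When $x$ and $z$ stand still, $d^+ = -CBK_D\,d$: this is where $M_D = CBK_D$ comes
  from. The eigenvalues of the sampled matrix split accordingly into fast ones near the eigenvalues
  of $-M_D$ and slow ones $1 + h\mu$ with $\mu$ near the eigenvalues of the ideal closed loop.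

  Instability. The sampled matrix converges entrywise as $h \to 0$, and its limit has each $-\mu$
  with $\mu$ an eigenvalue of $M_D$, $|\mu| > 1$, as an eigenvalue. If the sampled matrices were
  stable along some $h_k \to 0$, then $|\det(\mathcal A_{h_k} - z)| \ge (|z| - 1)^N$ for all
  $|z| > 1$, and by continuity of the determinant the limit could not have an eigenvalue outside the
  closed unit disk (\<open>eigenvalue_limit_le_1\<close>, \<open>fast_eigenvalues_bounded\<close>).

  Stability. Suppose that $\mathcal A_{h_k}$ has eigenvalues $\lambda_k$ with $|\lambda_k| \ge 1$ along
  some $h_k \to 0$. Normalise the eigenvectors in the coordinates $(x, z, d)$ and pass to a convergent
  subsequence, along which $1/\lambda_k$ converges as well. If the limit has $x = 0$ and $z = 0$, then
  $d \ne 0$ is an eigenvector of $M_D$ for an eigenvalue of modulus at least $1$. Otherwise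
  $\lambda_k \to 1$, the quotients $\mu_k = (\lambda_k - 1)/h_k$ converge, and the limit $\mu$ is an
  eigenvalue of the ideal matrix with eigenvector $(x, z)$; but $|1 + h_k\mu_k| \ge 1$ forces
  $\mathrm{Re}\,\mu \ge 0$. So $\rho(M_D) < 1$ and the Hurwitz property exclude both cases
  (\<open>no_limit_outside_unit_disk\<close>).\<close>

unbundle no vec_syntax

section \<open>Complexification of real matrices\<close>

lemma cmat_carrier [simp]: "cmat M \<in> carrier_mat r c \<longleftrightarrow> M \<in> carrier_mat r c"
  by (auto simp: cmat_def)

lemma cmat_dim [simp]: "dim_row (cmat M) = dim_row M" "dim_col (cmat M) = dim_col M"
  by (auto simp: cmat_def)

lemma cmat_index [simp]:
  "i < dim_row M \<Longrightarrow> j < dim_col M \<Longrightarrow> cmat M $$ (i, j) = complex_of_real (M $$ (i, j))"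
  by (auto simp: cmat_def)

lemma cmat_mult:
  "M \<in> carrier_mat r k \<Longrightarrow> N \<in> carrier_mat k c \<Longrightarrow> cmat (M * N) = cmat M * cmat N"
  unfolding cmat_def by (rule of_real_hom.mat_hom_mult)

lemma cmat_pow: "M \<in> carrier_mat k k \<Longrightarrow> cmat (M ^\<^sub>m j) = cmat M ^\<^sub>m j"
  unfolding cmat_def by (rule of_real_hom.mat_hom_pow)

lemma cmat_minus:
  "M \<in> carrier_mat r c \<Longrightarrow> N \<in> carrier_mat r c \<Longrightarrow> cmat (M - N) = cmat M - cmat N"
  by (rule eq_matI) auto

lemma cmat_uminus: "cmat (- M) = - cmat M"
  by (rule eq_matI) auto

lemma cmat_add:
  "M \<in> carrier_mat r c \<Longrightarrow> N \<in> carrier_mat r c \<Longrightarrow> cmat (M + N) = cmat M + cmat N"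
  by (rule eq_matI) auto

lemma cmat_one: "cmat (1\<^sub>m k) = 1\<^sub>m k"
  by (rule eq_matI) auto

lemma cmat_mult_vec:
  assumes "M \<in> carrier_mat r k" "N \<in> carrier_mat k c" "v \<in> carrier_vec c"
  shows "cmat (M * N) *\<^sub>v v = cmat M *\<^sub>v (cmat N *\<^sub>v v)"
  using assms by (simp add: cmat_mult assoc_mult_mat_vec[of _ r k _ c])

lemma smult_0_vec: "v \<in> carrier_vec N \<Longrightarrow> (0 :: complex) \<cdot>\<^sub>v v = 0\<^sub>v N"
  by (rule eq_vecI) auto

lemma smult_mat_mult_vec:
  fixes M :: "'a :: comm_ring_1 mat"
  assumes "M \<in> carrier_mat r c" "v \<in> carrier_vec c"
  shows "(a \<cdot>\<^sub>m M) *\<^sub>v v = a \<cdot>\<^sub>v (M *\<^sub>v v)"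
  by (rule eq_vecI) (use assms in \<open>auto simp: smult_scalar_prod_distrib[of _ c]\<close>)

lemma mult_mat_uminus_vec:
  fixes M :: "'a :: comm_ring_1 mat"
  assumes "M \<in> carrier_mat r c" "v \<in> carrier_vec c"
  shows "M *\<^sub>v (- v) = - (M *\<^sub>v v)"
  by (rule eq_vecI) (use assms in auto)

lemma cmat_four_block:
  "cmat (four_block_mat M1 M2 M3 M4) = four_block_mat (cmat M1) (cmat M2) (cmat M3) (cmat M4)"
  if "M1 \<in> carrier_mat r1 c1" "M2 \<in> carrier_mat r1 c2" "M3 \<in> carrier_mat r2 c1" "M4 \<in> carrier_mat r2 c2"
  unfolding cmat_def by (rule map_four_block_mat[OF that])

section \<open>Entrywise limits of complex vectors and matrices\<close>

text \<open>Entrywise convergence of a sequence of vectors. The dimension is an argument, and every member of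
  the sequence has to have it, because the vectors of all dimensions share one type.\<close>

definition tends_vec :: "nat \<Rightarrow> (nat \<Rightarrow> complex vec) \<Rightarrow> complex vec \<Rightarrow> bool" where
  "tends_vec N v v0 \<longleftrightarrow> (\<forall>k. v k \<in> carrier_vec N) \<and> v0 \<in> carrier_vec N \<and>
     (\<forall>i<N. (\<lambda>k. v k $ i) \<longlonglongrightarrow> v0 $ i)"

definition tends_mat :: "nat \<Rightarrow> nat \<Rightarrow> (nat \<Rightarrow> complex mat) \<Rightarrow> complex mat \<Rightarrow> bool" where
  "tends_mat r c M M0 \<longleftrightarrow> (\<forall>k. M k \<in> carrier_mat r c) \<and> M0 \<in> carrier_mat r c \<and>
     (\<forall>i<r. \<forall>j<c. (\<lambda>k. M k $$ (i, j)) \<longlonglongrightarrow> M0 $$ (i, j))"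

lemma tends_vecI:
  "(\<And>k. v k \<in> carrier_vec N) \<Longrightarrow> v0 \<in> carrier_vec N \<Longrightarrow>
    (\<And>i. i < N \<Longrightarrow> (\<lambda>k. v k $ i) \<longlonglongrightarrow> v0 $ i) \<Longrightarrow> tends_vec N v v0"
  by (simp add: tends_vec_def)

lemma tends_vecD:
  assumes "tends_vec N v v0"
  shows "v k \<in> carrier_vec N" "v0 \<in> carrier_vec N" "dim_vec (v k) = N" "dim_vec v0 = N"
    "i < N \<Longrightarrow> (\<lambda>k. v k $ i) \<longlonglongrightarrow> v0 $ i"
proof -
  show c: "v k \<in> carrier_vec N" "v0 \<in> carrier_vec N" using assms by (simp_all add: tends_vec_def)
  show "dim_vec (v k) = N" "dim_vec v0 = N" by (rule carrier_vecD[OF c(1)] carrier_vecD[OF c(2)])+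
  show "i < N \<Longrightarrow> (\<lambda>k. v k $ i) \<longlonglongrightarrow> v0 $ i" using assms by (simp add: tends_vec_def)
qed

lemma tends_vec_const: "v \<in> carrier_vec N \<Longrightarrow> tends_vec N (\<lambda>k. v) v"
  by (rule tends_vecI) simp_all

lemma tends_mat_const: "M \<in> carrier_mat r c \<Longrightarrow> tends_mat r c (\<lambda>k. M) M"
  by (simp add: tends_mat_def)

lemma tends_vec_add:
  assumes "tends_vec N v v0" "tends_vec N w w0"
  shows "tends_vec N (\<lambda>k. v k + w k) (v0 + w0)"
  by (rule tends_vecI)
    (simp_all add: tends_vecD[OF assms(1)] tends_vecD[OF assms(2)] tendsto_add)

lemma tends_vec_minus:
  assumes "tends_vec N v v0" "tends_vec N w w0"
  shows "tends_vec N (\<lambda>k. v k - w k) (v0 - w0)"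
  by (rule tends_vecI)
    (simp_all add: tends_vecD[OF assms(1)] tends_vecD[OF assms(2)] minus_carrier_vec tendsto_diff)

lemma tends_vec_uminus:
  assumes "tends_vec N v v0"
  shows "tends_vec N (\<lambda>k. - v k) (- v0)"
  by (rule tends_vecI) (simp_all add: tends_vecD[OF assms(1)] tendsto_minus)

lemma tends_vec_smult:
  assumes "c \<longlonglongrightarrow> c0" "tends_vec N v v0"
  shows "tends_vec N (\<lambda>k. c k \<cdot>\<^sub>v v k) (c0 \<cdot>\<^sub>v v0)"
  by (rule tends_vecI) (simp_all add: tends_vecD[OF assms(2)] tendsto_mult assms(1))

lemma tends_vec_append:
  assumes "tends_vec N v v0" "tends_vec L w w0"
  shows "tends_vec (N + L) (\<lambda>k. v k @\<^sub>v w k) (v0 @\<^sub>v w0)"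
proof (rule tends_vecI)
  note D = tends_vecD[OF assms(1)] tends_vecD[OF assms(2)]
  show "v k @\<^sub>v w k \<in> carrier_vec (N + L)" "v0 @\<^sub>v w0 \<in> carrier_vec (N + L)" for k
    by (intro append_carrier_vec D)+
  fix i assume i: "i < N + L"
  show "(\<lambda>k. (v k @\<^sub>v w k) $ i) \<longlonglongrightarrow> (v0 @\<^sub>v w0) $ i"
    using i by (cases "i < N") (simp_all add: D(3,4,5,8,9,10))
qed

lemma tends_vec_mult_mat:
  assumes "tends_mat r c M M0" "tends_vec c v v0"
  shows "tends_vec r (\<lambda>k. M k *\<^sub>v v k) (M0 *\<^sub>v v0)"
proof (rule tends_vecI)
  note v = tends_vecD[OF assms(2)]
  have M: "M k \<in> carrier_mat r c" "M0 \<in> carrier_mat r c"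
    "i < r \<Longrightarrow> j < c \<Longrightarrow> (\<lambda>k. M k $$ (i, j)) \<longlonglongrightarrow> M0 $$ (i, j)" for i j k
    using assms(1) by (simp_all add: tends_mat_def)
  show "M k *\<^sub>v v k \<in> carrier_vec r" "M0 *\<^sub>v v0 \<in> carrier_vec r" for k
    by (rule mult_mat_vec_carrier M v)+
  fix i assume i: "i < r"
  have entry: "(P *\<^sub>v w) $ i = (\<Sum>j<c. P $$ (i, j) * w $ j)"
    if "P \<in> carrier_mat r c" "w \<in> carrier_vec c" for P and w :: "complex vec"
    using that i by (auto simp: scalar_prod_def atLeast0LessThan)
  show "(\<lambda>k. (M k *\<^sub>v v k) $ i) \<longlonglongrightarrow> (M0 *\<^sub>v v0) $ i"
    unfolding entry[OF M(1) v(1)] entry[OF M(2) v(2)]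
    using i by (intro tendsto_sum tendsto_mult M(3) v(5)) simp_all
qed

lemma tends_vec_unique:
  assumes "tends_vec N v v0" "tends_vec N v v1"
  shows "v0 = v1"
proof (rule eq_vecI)
  show "dim_vec v0 = dim_vec v1" using assms by (auto simp: tends_vec_def)
  fix i assume "i < dim_vec v1"
  then have "i < N" using tends_vecD[OF assms(2)] by simp
  then show "v0 $ i = v1 $ i"
    using LIMSEQ_unique[OF tends_vecD(5)[OF assms(1)] tends_vecD(5)[OF assms(2)]] by simp
qed

lemma tends_vec_subseq:
  "tends_vec N v v0 \<Longrightarrow> strict_mono s \<Longrightarrow> tends_vec N (\<lambda>k. v (s k)) v0"
  by (auto simp: tends_vec_def intro: LIMSEQ_subseq_LIMSEQ[unfolded o_def])

lemma finite_family_convergent_subseq: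
  fixes f :: "'i \<Rightarrow> nat \<Rightarrow> complex"
  assumes "finite I" "\<And>i k. i \<in> I \<Longrightarrow> cmod (f i k) \<le> b"
  shows "\<exists>s. strict_mono (s :: nat \<Rightarrow> nat) \<and> (\<forall>i\<in>I. \<exists>l. (\<lambda>k. f i (s k)) \<longlonglongrightarrow> l)"
  using assms
proof (induction I rule: finite_induct)
  case empty
  show ?case by (rule exI[of _ id]) (auto simp: strict_mono_def)
next
  case (insert a I)
  obtain s where s: "strict_mono s" "\<forall>i\<in>I. \<exists>l. (\<lambda>k. f i (s k)) \<longlonglongrightarrow> l"
    using insert by auto
  have "\<And>k. f a (s k) \<in> cball 0 b" using insert.prems by simp
  then obtain l t where t: "strict_mono t" "((\<lambda>k. f a (s k)) \<circ> t) \<longlonglongrightarrow> l"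
    using compact_cball[unfolded compact_def, rule_format, of "\<lambda>k. f a (s k)" 0 b] by blast
  have "\<exists>l. (\<lambda>k. f i (s (t k))) \<longlonglongrightarrow> l" if i: "i \<in> I" for i
  proof -
    obtain l' where "(\<lambda>k. f i (s k)) \<longlonglongrightarrow> l'" using s(2) i by blast
    from LIMSEQ_subseq_LIMSEQ[OF this t(1)] show ?thesis by (auto simp: o_def)
  qed
  moreover have "(\<lambda>k. f a (s (t k))) \<longlonglongrightarrow> l" using t(2) by (simp add: o_def)
  ultimately have "\<forall>i\<in>insert a I. \<exists>l. (\<lambda>k. f i ((s \<circ> t) k)) \<longlonglongrightarrow> l" by auto
  then show ?case using strict_mono_o[OF s(1) t(1)] by blast
qed

lemma bounded_vec_convergent_subseq:
  fixes v :: "nat \<Rightarrow> complex vec"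
  assumes c: "\<And>k. v k \<in> carrier_vec N" and b: "\<And>k i. i < N \<Longrightarrow> cmod (v k $ i) \<le> b"
  shows "\<exists>s v0. strict_mono s \<and> tends_vec N (\<lambda>k. v (s k)) v0"
proof -
  obtain s where s: "strict_mono (s :: nat \<Rightarrow> nat)"
    "\<forall>i\<in>{..<N}. \<exists>l. (\<lambda>k. v (s k) $ i) \<longlonglongrightarrow> l"
    using finite_family_convergent_subseq[of "{..<N}" "\<lambda>i k. v k $ i" b] b by auto
  then obtain l where l: "\<And>i. i < N \<Longrightarrow> (\<lambda>k. v (s k) $ i) \<longlonglongrightarrow> l i" by (metis lessThan_iff)
  have "tends_vec N (\<lambda>k. v (s k)) (vec N l)" using c l by (auto simp: tends_vec_def)
  with s show ?thesis by blast
qed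

lemma tendsto_det:
  assumes "tends_mat N N M M0"
  shows "(\<lambda>k. det (M k)) \<longlonglongrightarrow> det M0"
proof -
  have "\<And>k. M k \<in> carrier_mat N N" "M0 \<in> carrier_mat N N" using assms by (auto simp: tends_mat_def)
  note d = this[THEN det_def']
  have *: "p permutes {0..<N} \<Longrightarrow> i < N \<Longrightarrow> p i < N" for p i
    using permutes_in_image[of p "{0..<N}" i] by auto
  show ?thesis unfolding d
    by (intro tendsto_sum tendsto_mult tendsto_prod tendsto_const)
      (use assms in \<open>auto simp: tends_mat_def *\<close>)
qed

text \<open>It is enough to know the action of the matrices on fixed vectors, which for the sampled matrix is
  much more readable than its blocks.\<close>

lemma tends_mat_if_columns_converge:
  assumes M: "\<And>k. M k \<in> carrier_mat N N"
    and lim: "\<And>v. v \<in> carrier_vec N \<Longrightarrow> \<exists>v0. tends_vec N (\<lambda>k. M k *\<^sub>v v) v0"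
  shows "\<exists>M0. tends_mat N N M M0"
proof -
  have "\<exists>v0. tends_vec N (\<lambda>k. M k *\<^sub>v unit_vec N j) v0" for j by (rule lim) simp
  then obtain c where c: "\<And>j. tends_vec N (\<lambda>k. M k *\<^sub>v unit_vec N j) (c j)" by metis
  have "tends_mat N N M (mat N N (\<lambda>(i, j). c j $ i))"
    unfolding tends_mat_def
  proof (intro conjI allI impI)
    fix i j assume ij: "i < N" "j < N"
    have "(M k *\<^sub>v unit_vec N j) $ i = M k $$ (i, j)" for k
      using ij M[of k] by auto
    then show "(\<lambda>k. M k $$ (i, j)) \<longlonglongrightarrow> mat N N (\<lambda>(i, j). c j $ i) $$ (i, j)"
      using tends_vecD(5)[OF c ij(1), of j] ij by simp
  qed (simp_all add: M)
  then show ?thesis by blast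
qed

text \<open>The $\ell^1$ norm: its continuity under entrywise limits is immediate, so that a normalised sequence
  cannot have the limit zero.\<close>

definition norm1_vec :: "complex vec \<Rightarrow> real" where
  "norm1_vec v = (\<Sum>i<dim_vec v. cmod (v $ i))"

lemma norm1_vec_nonneg: "0 \<le> norm1_vec v"
  by (simp add: norm1_vec_def sum_nonneg)

lemma norm1_vec_eq_0: "v \<in> carrier_vec N \<Longrightarrow> norm1_vec v = 0 \<longleftrightarrow> v = 0\<^sub>v N"
  by (auto simp: norm1_vec_def sum_nonneg_eq_0_iff intro!: eq_vecI)

lemma norm1_vec_smult: "norm1_vec (c \<cdot>\<^sub>v v) = cmod c * norm1_vec v"
  by (simp add: norm1_vec_def norm_mult sum_distrib_left)

lemma entry_le_norm1_vec: "i < dim_vec v \<Longrightarrow> cmod (v $ i) \<le> norm1_vec v"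
  unfolding norm1_vec_def by (rule member_le_sum) auto

lemma tendsto_norm1_vec:
  assumes "tends_vec N v v0"
  shows "(\<lambda>k. norm1_vec (v k)) \<longlonglongrightarrow> norm1_vec v0"
  unfolding norm1_vec_def tends_vecD(3,4)[OF assms]
  by (intro tendsto_sum tendsto_norm tends_vecD(5)[OF assms]) simp

text \<open>The scalars are recovered as a quotient of entries, at an index where the limit vector does not
  vanish.\<close>

lemma quotient_converges:
  assumes v: "tends_vec N v v0" and F: "tends_vec N F F0"
    and eq: "\<And>k. \<mu> k \<cdot>\<^sub>v v k = F k" and nz: "v0 \<noteq> 0\<^sub>v N"
  shows "\<exists>\<mu>0. \<mu> \<longlonglongrightarrow> (\<mu>0 :: complex)"
proof -
  obtain i where i: "i < N" "v0 $ i \<noteq> 0"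
    using nz tends_vecD(2,4)[OF v] by (metis eq_vecI index_zero_vec)
  have "\<mu> k * v k $ i = F k $ i" for k
    unfolding eq[symmetric] using i tends_vecD(3)[OF v] by simp
  moreover have "eventually (\<lambda>k. v k $ i \<noteq> 0) sequentially"
    using tendsto_imp_eventually_ne[OF tends_vecD(5)[OF v i(1)] i(2)] .
  ultimately have "eventually (\<lambda>k. F k $ i / v k $ i = \<mu> k) sequentially"
    by (elim eventually_mono) (metis nonzero_mult_div_cancel_right)
  moreover have "(\<lambda>k. F k $ i / v k $ i) \<longlonglongrightarrow> F0 $ i / v0 $ i"
    by (intro tendsto_divide tends_vecD(5)[OF F] tends_vecD(5)[OF v] i)
  ultimately show ?thesis using Lim_transform_eventually by blast
qed

section \<open>The matrix exponential and its integral for small times\<close>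

text \<open>This geometric bound gives the exponential series an infinite radius of convergence in each entry.\<close>

lemma pow_entry_bound:
  assumes A: "A \<in> carrier_mat n n"
  shows "\<exists>b\<ge>0. \<forall>k. \<forall>i<n. \<forall>j<n. \<bar>(A ^\<^sub>m k) $$ (i, j)\<bar> \<le> (b :: real) ^ k"
proof -
  obtain a where a: "norm_bound A a" using norm_bound_max by blast
  define b where "b = max a 0 * real n"
  have a': "norm_bound A (max a 0)" using a by (force simp: norm_bound_def)
  have "norm_bound (A ^\<^sub>m k) (b ^ k)" for k
  proof (induction k)
    case 0
    show ?case using A by (auto simp: norm_bound_def)
  next
    case (Suc k)
    show ?case using norm_bound_mult[OF pow_carrier_mat[OF A] A Suc a']
      by (simp add: b_def mult.assoc mult.commute)
  qed
  moreover have "b \<ge> 0" by (simp add: b_def)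
  ultimately show ?thesis using A
    by (intro exI[of _ b]) (auto simp: norm_bound_def pow_carrier_mat)
qed

lemma pow_smult_mat:
  assumes A: "(A :: 'a :: comm_ring_1 mat) \<in> carrier_mat n n"
  shows "(t \<cdot>\<^sub>m A) ^\<^sub>m k = t ^ k \<cdot>\<^sub>m (A ^\<^sub>m k)"
proof (induction k)
  case 0
  show ?case using A by auto
next
  case (Suc k)
  have "(t ^ k \<cdot>\<^sub>m A ^\<^sub>m k) * (t \<cdot>\<^sub>m A) = t \<cdot>\<^sub>m (t ^ k \<cdot>\<^sub>m (A ^\<^sub>m k * A))"
    using A by (simp add: mult_smult_assoc_mat[of _ n n _ n] mult_smult_distrib[of _ n n _ n]
        pow_carrier_mat)
  also have "\<dots> = (t * t ^ k) \<cdot>\<^sub>m (A ^\<^sub>m k * A)"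
    by (rule eq_matI) (simp_all add: mult.assoc)
  finally have "(t ^ k \<cdot>\<^sub>m A ^\<^sub>m k) * (t \<cdot>\<^sub>m A) = (t * t ^ k) \<cdot>\<^sub>m (A ^\<^sub>m k * A)" .
  then show ?case by (simp add: Suc)
qed

lemma Phi_carrier: "A \<in> carrier_mat n n \<Longrightarrow> Phi A h \<in> carrier_mat n n"
  by (auto simp: Phi_def mat_exp_def)

lemma Gam_carrier: "A \<in> carrier_mat n n \<Longrightarrow> Gam A h \<in> carrier_mat n n"
  by (auto simp: Gam_def)

lemma Phi_index:
  assumes A: "A \<in> carrier_mat n n" and ij: "i < n" "j < n"
  shows "Phi A h $$ (i, j) = (\<Sum>k. ((A ^\<^sub>m k) $$ (i, j) / fact k) * h ^ k)"
  using A ij pow_carrier_mat[OF A]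
  by (auto simp: Phi_def mat_exp_def pow_smult_mat[OF A] mult.commute)

lemma Phi_summable:
  assumes A: "A \<in> carrier_mat n n" and ij: "i < n" "j < n"
  shows "summable (\<lambda>k. ((A ^\<^sub>m k) $$ (i, j) / fact k) * (h :: real) ^ k)"
proof -
  obtain b where b: "b \<ge> 0" "\<And>k. \<bar>(A ^\<^sub>m k) $$ (i, j)\<bar> \<le> b ^ k"
    using pow_entry_bound[OF A] ij by blast
  have "summable (\<lambda>k. (b * \<bar>h\<bar>) ^ k /\<^sub>R fact k)" by (rule summable_exp_generic)
  then show ?thesis
  proof (rule summable_comparison_test'[where N = 0])
    fix k
    have "\<bar>(A ^\<^sub>m k) $$ (i, j)\<bar> * \<bar>h\<bar> ^ k / fact k \<le> b ^ k * \<bar>h\<bar> ^ k / fact k"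
      by (intro divide_right_mono mult_right_mono b) auto
    then show "norm ((A ^\<^sub>m k) $$ (i, j) / fact k * h ^ k) \<le> (b * \<bar>h\<bar>) ^ k /\<^sub>R fact k"
      by (simp add: abs_mult power_abs power_mult_distrib field_simps)
  qed
qed

lemma Phi_deriv_0:
  assumes A: "A \<in> carrier_mat n n" and ij: "i < n" "j < n"
  shows "((\<lambda>h. Phi A h $$ (i, j)) has_real_derivative A $$ (i, j)) (at 0)"
proof -
  let ?c = "\<lambda>k. (A ^\<^sub>m k) $$ (i, j) / fact k"
  have "diffs ?c 0 = A $$ (i, j)"
    using A by (simp add: diffs_def del: index_mult_mat)
  then have "(\<Sum>k. diffs ?c k * 0 ^ k) = A $$ (i, j)" by (simp only: powser_zero)
  then show ?thesis
    using termdiffs_strong_converges_everywhere[OF Phi_summable[OF assms], of 0]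
    by (simp add: Phi_index[OF assms])
qed

lemma Phi_cont:
  assumes A: "A \<in> carrier_mat n n" and ij: "i < n" "j < n"
  shows "continuous_on S (\<lambda>h. Phi A h $$ (i, j))"
  using isCont_powser_converges_everywhere[OF Phi_summable[OF assms]]
  by (auto simp: Phi_index[OF assms] intro: continuous_at_imp_continuous_on)

lemma Phi_0:
  assumes A: "A \<in> carrier_mat n n" and ij: "i < n" "j < n"
  shows "Phi A 0 $$ (i, j) = 1\<^sub>m n $$ (i, j)"
  unfolding Phi_index[OF assms] powser_zero using A by simp

text \<open>Each entry of $e^{Ah}$ is an everywhere convergent power series in $h$ with linear coefficient
  $A_{ij}$, so the quotient is a difference quotient at $0$.\<close>

lemma Phi_quotient_tendsto:
  assumes A: "A \<in> carrier_mat n n" and h: "\<And>k. h k > 0" "h \<longlonglongrightarrow> 0"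
  shows "tends_mat n n (\<lambda>k. cmat ((1 / h k) \<cdot>\<^sub>m (Phi A (h k) - 1\<^sub>m n))) (cmat A)"
  unfolding tends_mat_def
proof (intro conjI allI impI)
  note P = Phi_carrier[OF A]
  show "cmat ((1 / h k) \<cdot>\<^sub>m (Phi A (h k) - 1\<^sub>m n)) \<in> carrier_mat n n" for k
    by (auto intro!: minus_carrier_mat)
  show "cmat A \<in> carrier_mat n n" using A by simp
  fix i j assume ij: "i < n" "j < n"
  have "((\<lambda>y. (Phi A y $$ (i, j) - Phi A 0 $$ (i, j)) / y) \<longlongrightarrow> A $$ (i, j)) (at 0)"
    using Phi_deriv_0[OF A ij] by (simp add: has_field_derivative_iff)
  moreover have "filterlim h (at 0) sequentially"
    using h by (auto simp: filterlim_at less_imp_neq[OF h(1), symmetric])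
  ultimately have "(\<lambda>k. (Phi A (h k) $$ (i, j) - Phi A 0 $$ (i, j)) / h k) \<longlonglongrightarrow> A $$ (i, j)"
    by (rule filterlim_compose)
  from tendsto_of_real[OF this, where 'a = complex]
  show "(\<lambda>k. cmat ((1 / h k) \<cdot>\<^sub>m (Phi A (h k) - 1\<^sub>m n)) $$ (i, j)) \<longlonglongrightarrow> cmat A $$ (i, j)"
    using A P ij by (simp add: Phi_0[OF A ij] carrier_matD[OF P])
qed

text \<open>The fundamental theorem of calculus at the left end point, with $e^{A \cdot 0} = I$.\<close>

lemma Gam_quotient_tendsto:
  assumes A: "A \<in> carrier_mat n n" and h: "\<And>k. h k > 0" "h \<longlonglongrightarrow> 0"
  shows "tends_mat n n (\<lambda>k. cmat ((1 / h k) \<cdot>\<^sub>m Gam A (h k))) (1\<^sub>m n)"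
  unfolding tends_mat_def
proof (intro conjI allI impI)
  note G = Gam_carrier[OF A]
  show "cmat ((1 / h k) \<cdot>\<^sub>m Gam A (h k)) \<in> carrier_mat n n" for k using G by simp
  show "1\<^sub>m n \<in> carrier_mat n n" by simp
  fix i j assume ij: "i < n" "j < n"
  let ?I = "\<lambda>y. integral {0..y} (\<lambda>\<tau>. Phi A \<tau> $$ (i, j))"
  have "(?I has_real_derivative Phi A 0 $$ (i, j)) (at 0 within {0..1})"
    by (rule integral_has_real_derivative[OF Phi_cont[OF A ij]]) simp
  then have "((\<lambda>y. ?I y / y) \<longlongrightarrow> 1\<^sub>m n $$ (i, j)) (at 0 within {0..1})"
    by (simp add: has_field_derivative_iff Phi_0[OF A ij])
  moreover have "filterlim h (at 0 within {0..1}) sequentially"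
  proof -
    have "eventually (\<lambda>k. h k < 1) sequentially" using h(2) by (rule order_tendstoD) simp
    then show ?thesis
      using h by (auto simp: filterlim_at less_imp_neq[OF h(1), symmetric] less_imp_le
          elim!: eventually_mono)
  qed
  ultimately have "(\<lambda>k. ?I (h k) / h k) \<longlonglongrightarrow> 1\<^sub>m n $$ (i, j)" by (rule filterlim_compose)
  from tendsto_of_real[OF this, where 'a = complex]
  show "(\<lambda>k. cmat ((1 / h k) \<cdot>\<^sub>m Gam A (h k)) $$ (i, j)) \<longlonglongrightarrow> 1\<^sub>m n $$ (i, j)"
    using A ij carrier_matD[OF G] by (cases "i = j") (simp_all add: Gam_def)
qed

section \<open>Exponential stability and eigenvalues\<close>

lemma eigenvalue_smult:
  fixes M :: "'a :: field mat"
  assumes M: "M \<in> carrier_mat N N" and c: "c \<noteq> 0" and ev: "eigenvalue (c \<cdot>\<^sub>m M) \<mu>"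
  shows "eigenvalue M (\<mu> / c)"
proof -
  obtain v where v: "v \<in> carrier_vec N" "v \<noteq> 0\<^sub>v N" "(c \<cdot>\<^sub>m M) *\<^sub>v v = \<mu> \<cdot>\<^sub>v v"
    using ev M by (auto simp: eigenvalue_def eigenvector_def)
  have "(c \<cdot>\<^sub>m M) *\<^sub>v v = c \<cdot>\<^sub>v (M *\<^sub>v v)"
    by (rule smult_mat_mult_vec[OF M v(1)])
  then have "(1 / c) \<cdot>\<^sub>v (c \<cdot>\<^sub>v (M *\<^sub>v v)) = (1 / c) \<cdot>\<^sub>v (\<mu> \<cdot>\<^sub>v v)" using v(3) by simp
  then have "M *\<^sub>v v = (\<mu> / c) \<cdot>\<^sub>v v" using c by (simp add: smult_smult_assoc)
  then show ?thesis using v M by (auto simp: eigenvalue_def eigenvector_def)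
qed

lemma spectral_radius_less_iff:
  assumes M: "M \<in> carrier_mat N N" and N: "N > 0"
  shows "spectral_radius M < r \<longleftrightarrow> (\<forall>\<mu>. eigenvalue M \<mu> \<longrightarrow> cmod \<mu> < r)"
  using spectral_radius_mem_max[OF M N] by (force simp: spectrum_def)

text \<open>A matrix with spectral radius below $1$ has bounded powers. Applied to $M/\gamma$ with $\gamma$
  strictly between $\rho(M)$ and $1$, this improves to geometric decay.\<close>

lemma pow_entries_decay:
  assumes M: "M \<in> carrier_mat N N" and N: "N > 0"
    and ev: "\<And>\<mu>. eigenvalue M \<mu> \<Longrightarrow> cmod \<mu> < 1"
  shows "\<exists>c \<gamma>. c > 0 \<and> 0 < \<gamma> \<and> \<gamma> < 1 \<and> (\<forall>k. \<forall>i<N. \<forall>j<N. cmod ((M ^\<^sub>m k) $$ (i, j)) \<le> c * \<gamma> ^ k)"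
proof -
  have sr: "spectral_radius M < 1" using spectral_radius_less_iff[OF M N] ev by simp
  have sr0: "0 \<le> spectral_radius M"
    using spectral_radius_mem_max(1)[OF M N] by auto
  define \<gamma> where "\<gamma> = (1 + spectral_radius M) / 2"
  have g: "0 < \<gamma>" "\<gamma> < 1" "spectral_radius M < \<gamma>" using sr sr0 by (simp_all add: \<gamma>_def)
  let ?c = "complex_of_real (1 / \<gamma>)"
  have S: "?c \<cdot>\<^sub>m M \<in> carrier_mat N N" using M by simp
  have "cmod \<mu> < 1" if "eigenvalue (?c \<cdot>\<^sub>m M) \<mu>" for \<mu>
  proof -
    have "eigenvalue M (\<mu> / ?c)" by (rule eigenvalue_smult[OF M _ that]) (use g in simp)
    then have "cmod (\<mu> / ?c) < \<gamma>" using spectral_radius_less_iff[OF M N] g(3) by blast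
    then have "cmod \<mu> * \<gamma> < \<gamma>" using g(1) by (simp add: norm_divide norm_mult)
    then show ?thesis using g(1) by simp
  qed
  then have "spectral_radius (?c \<cdot>\<^sub>m M) < 1" using spectral_radius_less_iff[OF S N] by simp
  then obtain b where b: "\<And>k. norm_bound ((?c \<cdot>\<^sub>m M) ^\<^sub>m k) b"
    using spectral_radius_jnf_norm_bound_less_1_upper_triangular[OF S] by blast
  have "cmod ((M ^\<^sub>m k) $$ (i, j)) \<le> max b 1 * \<gamma> ^ k" if ij: "i < N" "j < N" for k i j
  proof -
    have Mk: "M ^\<^sub>m k \<in> carrier_mat N N" by (rule pow_carrier_mat[OF M])
    have "cmod ((?c ^ k \<cdot>\<^sub>m (M ^\<^sub>m k)) $$ (i, j)) \<le> b"
      by (rule b[of k, unfolded pow_smult_mat[OF M] norm_bound_def, rule_format])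
        (use ij carrier_matD[OF Mk] in simp_all)
    moreover have "(?c ^ k \<cdot>\<^sub>m (M ^\<^sub>m k)) $$ (i, j) = ?c ^ k * (M ^\<^sub>m k) $$ (i, j)"
      by (rule index_smult_mat(1)) (use ij carrier_matD[OF Mk] in simp_all)
    ultimately have "cmod ((M ^\<^sub>m k) $$ (i, j)) / \<gamma> ^ k \<le> b"
      using g(1) by (simp add: norm_mult norm_power norm_divide power_one_over)
    then have "cmod ((M ^\<^sub>m k) $$ (i, j)) \<le> b * \<gamma> ^ k" using g(1) by (simp add: pos_divide_le_eq)
    also have "\<dots> \<le> max b 1 * \<gamma> ^ k" using g(1) by (intro mult_right_mono) auto
    finally show ?thesis .
  qed
  then show ?thesis using g by (intro exI[of _ "max b 1"] exI[of _ \<gamma>]) auto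
qed

lemma vec_enorm_sq: "vec_enorm v ^ 2 = (\<Sum>i<dim_vec v. (v $ i)\<^sup>2)"
  by (simp add: vec_enorm_def scalar_prod_def atLeast0LessThan sum_nonneg power2_eq_square)

lemma abs_entry_le_enorm: "i < dim_vec v \<Longrightarrow> \<bar>v $ i\<bar> \<le> vec_enorm v"
proof (rule power2_le_imp_le)
  assume "i < dim_vec v"
  then have "(v $ i)\<^sup>2 \<le> (\<Sum>i<dim_vec v. (v $ i)\<^sup>2)" by (intro member_le_sum) auto
  then show "\<bar>v $ i\<bar>\<^sup>2 \<le> (vec_enorm v)\<^sup>2" by (simp add: vec_enorm_sq)
  show "0 \<le> vec_enorm v" by (simp add: vec_enorm_def scalar_prod_def sum_nonneg)
qed

lemma enorm_le_of_entries:
  assumes b: "\<And>i. i < dim_vec v \<Longrightarrow> \<bar>v $ i\<bar> \<le> b" and b0: "0 \<le> b"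
  shows "vec_enorm v \<le> real (dim_vec v) * b"
proof (rule power2_le_imp_le)
  have "(\<Sum>i<dim_vec v. (v $ i)\<^sup>2) \<le> (\<Sum>i<dim_vec v. b\<^sup>2)"
    using b by (intro sum_mono) (metis abs_le_square_iff abs_of_nonneg b0 lessThan_iff)
  also have "\<dots> \<le> (real (dim_vec v))\<^sup>2 * b\<^sup>2"
  proof -
    have "real d \<le> (real d)\<^sup>2" for d by (cases d) (simp_all add: power2_eq_square)
    then show ?thesis by (simp add: mult_right_mono)
  qed
  finally show "(vec_enorm v)\<^sup>2 \<le> (real (dim_vec v) * b)\<^sup>2"
    by (simp add: vec_enorm_sq power_mult_distrib)
  show "0 \<le> real (dim_vec v) * b" using b0 by simp
qed

lemma iterate_eq_pow:
  assumes M: "M \<in> carrier_mat N N" and s0: "s 0 \<in> carrier_vec N"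
    and s: "\<And>k. s (Suc k) = M *\<^sub>v s k"
  shows "s k = (M ^\<^sub>m k) *\<^sub>v s 0"
  using s0 s
proof (induction k arbitrary: s)
  case 0
  then show ?case using M by simp
next
  case (Suc k)
  have "s (Suc k) = (M ^\<^sub>m k) *\<^sub>v s (Suc 0)"
    using Suc.IH[of "\<lambda>k. s (Suc k)"] Suc.prems M by simp
  also have "\<dots> = (M ^\<^sub>m Suc k) *\<^sub>v s 0"
    using assoc_mult_mat_vec[OF pow_carrier_mat[OF M] M Suc.prems(1)] Suc.prems(2) by simp
  finally show ?case .
qed

text \<open>The powers decay geometrically in each entry. Passing from entries to the Euclidean norm and from
  the matrix to its action on the initial state costs one factor $N$ each.\<close>

lemma exponentially_stable_if_eigenvalues:
  assumes M: "M \<in> carrier_mat N N" and N: "N > 0"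
    and ev: "\<And>\<mu>. eigenvalue (cmat M) \<mu> \<Longrightarrow> cmod \<mu> < 1"
  shows "dt_exponentially_stable M"
proof -
  have cM: "cmat M \<in> carrier_mat N N" using M by simp
  obtain c \<gamma> where c: "c > 0" "0 < \<gamma>" "\<gamma> < 1"
    and b: "\<And>k i j. i < N \<Longrightarrow> j < N \<Longrightarrow> cmod ((cmat M ^\<^sub>m k) $$ (i, j)) \<le> c * \<gamma> ^ k"
    using pow_entries_decay[OF cM N ev] by blast
  have b': "\<bar>(M ^\<^sub>m k) $$ (i, j)\<bar> \<le> c * \<gamma> ^ k" if "i < N" "j < N" for k i j
    using b[OF that, of k] that carrier_matD[OF pow_carrier_mat[OF M, of k]]
    by (simp add: cmat_pow[OF M, symmetric])
  have "vec_enorm (s k) \<le> (real N * (real N * c)) * \<gamma> ^ k * vec_enorm (s 0)"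
    if s0: "s 0 \<in> carrier_vec N" and s: "\<And>k. s (Suc k) = M *\<^sub>v s k" for s k
  proof -
    have Mk: "M ^\<^sub>m k \<in> carrier_mat N N" by (rule pow_carrier_mat[OF M])
    have sk: "s k = (M ^\<^sub>m k) *\<^sub>v s 0" by (rule iterate_eq_pow[OF M s0 s])
    have dim: "dim_vec (s k) = N" using carrier_matD(1)[OF Mk] unfolding sk by simp
    have nn: "0 \<le> vec_enorm (s 0)" by (simp add: vec_enorm_def scalar_prod_def sum_nonneg)
    have "\<bar>s k $ i\<bar> \<le> real N * (c * \<gamma> ^ k * vec_enorm (s 0))" if i: "i < N" for i
    proof -
      have "(Q *\<^sub>v s 0) $ i = (\<Sum>j<N. Q $$ (i, j) * s 0 $ j)" if "Q \<in> carrier_mat N N" for Q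
        using that s0 i by (auto simp: scalar_prod_def atLeast0LessThan)
      from this[OF Mk] have "s k $ i = (\<Sum>j<N. (M ^\<^sub>m k) $$ (i, j) * s 0 $ j)" by (simp add: sk)
      also have "\<bar>\<dots>\<bar> \<le> (\<Sum>j<N. \<bar>(M ^\<^sub>m k) $$ (i, j)\<bar> * \<bar>s 0 $ j\<bar>)"
        using sum_abs by (auto simp: abs_mult[symmetric])
      also have "\<dots> \<le> (\<Sum>j<N. c * \<gamma> ^ k * vec_enorm (s 0))"
        using b'[OF i] s0 c by (intro sum_mono mult_mono abs_entry_le_enorm) auto
      finally show ?thesis by simp
    qed
    from enorm_le_of_entries[of "s k", unfolded dim, OF this] show ?thesis
      using c nn by (simp add: mult_ac)
  qed
  then show ?thesis unfolding dt_exponentially_stable_def carrier_matD[OF M]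
    by (intro exI[of _ "real N * (real N * c)"] exI[of _ \<gamma>]) (use c N in auto)
qed

lemma Re_cmat_mult_vec:
  assumes "M \<in> carrier_mat r c" "v \<in> carrier_vec c"
  shows "map_vec Re (cmat M *\<^sub>v v) = M *\<^sub>v map_vec Re v"
  using assms by (intro eq_vecI) (auto simp: scalar_prod_def)

lemma Im_cmat_mult_vec:
  assumes "M \<in> carrier_mat r c" "v \<in> carrier_vec c"
  shows "map_vec Im (cmat M *\<^sub>v v) = M *\<^sub>v map_vec Im v"
  using assms by (intro eq_vecI) (auto simp: scalar_prod_def)

lemma complex_vec_eqI:
  "map_vec Re v = map_vec Re w \<Longrightarrow> map_vec Im v = map_vec Im w \<Longrightarrow> v = w"
  by (rule eq_vecI) (metis complex_eqI index_map_vec)+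

text \<open>A complex eigenvector $v$ yields the two real trajectories $\mathrm{Re}(\mu^k v)$ and
  $\mathrm{Im}(\mu^k v)$. Both decay, hence so does $|\mu|^k |v_i|$.\<close>

lemma eigenvalues_if_exponentially_stable:
  assumes M: "M \<in> carrier_mat N N" and st: "dt_exponentially_stable M"
    and ev: "eigenvalue (cmat M) \<mu>"
  shows "cmod \<mu> < 1"
proof (rule ccontr)
  assume "\<not> cmod \<mu> < 1"
  then have mu: "cmod \<mu> \<ge> 1" by simp
  obtain v where v: "v \<in> carrier_vec N" "v \<noteq> 0\<^sub>v N" "cmat M *\<^sub>v v = \<mu> \<cdot>\<^sub>v v"
    using ev M by (auto simp: eigenvalue_def eigenvector_def)
  obtain i where i: "i < N" "v $ i \<noteq> 0"
    using v(1,2) by (metis carrier_vecD eq_vecI index_zero_vec zero_carrier_vec)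
  obtain c \<gamma> where c: "c > 0" "0 < \<gamma>" "\<gamma> < 1"
    and b: "\<And>s k. s 0 \<in> carrier_vec N \<Longrightarrow> (\<And>k. s (Suc k) = M *\<^sub>v s k) \<Longrightarrow>
      vec_enorm (s k) \<le> c * \<gamma> ^ k * vec_enorm (s 0)"
    using st M unfolding dt_exponentially_stable_def carrier_matD[OF M] by blast
  define w where "w k = \<mu> ^ k \<cdot>\<^sub>v v" for k
  have w: "w k \<in> carrier_vec N" for k using v(1) by (simp add: w_def)
  have "cmat M *\<^sub>v w k = w (Suc k)" for k
    using mult_mat_vec[of "cmat M" N N v] M v by (simp add: w_def smult_smult_assoc mult.commute)
  then have "map_vec Re (w (Suc k)) = M *\<^sub>v map_vec Re (w k)"
    "map_vec Im (w (Suc k)) = M *\<^sub>v map_vec Im (w k)" for k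
    using Re_cmat_mult_vec[OF M w] Im_cmat_mult_vec[OF M w] by simp_all
  then have "vec_enorm (map_vec Re (w k)) \<le> c * \<gamma> ^ k * vec_enorm (map_vec Re (w 0))"
    "vec_enorm (map_vec Im (w k)) \<le> c * \<gamma> ^ k * vec_enorm (map_vec Im (w 0))" for k
    using b[of "\<lambda>k. map_vec Re (w k)"] b[of "\<lambda>k. map_vec Im (w k)"] w by simp_all
  moreover have "\<bar>Re (w k $ i)\<bar> \<le> vec_enorm (map_vec Re (w k))"
    "\<bar>Im (w k $ i)\<bar> \<le> vec_enorm (map_vec Im (w k))" for k
    using abs_entry_le_enorm[of i "map_vec Re (w k)"] abs_entry_le_enorm[of i "map_vec Im (w k)"]
      i(1) w[of k] by auto
  ultimately have "cmod (w k $ i) \<le> c * \<gamma> ^ k * vec_enorm (map_vec Re (w 0))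
      + c * \<gamma> ^ k * vec_enorm (map_vec Im (w 0))" for k
    using cmod_le[of "w k $ i"] by (meson add_mono order_trans)
  moreover have "cmod (v $ i) \<le> cmod (w k $ i)" for k
  proof -
    have "1 \<le> cmod \<mu> ^ k" using mu by simp
    then have "1 * cmod (v $ i) \<le> cmod \<mu> ^ k * cmod (v $ i)" by (intro mult_right_mono) auto
    then show ?thesis using i(1) v(1) by (simp add: w_def norm_mult norm_power)
  qed
  ultimately have le: "cmod (v $ i) \<le> c * \<gamma> ^ k * vec_enorm (map_vec Re (w 0))
      + c * \<gamma> ^ k * vec_enorm (map_vec Im (w 0))" for k
    by (meson order_trans)
  have "(\<lambda>k. \<gamma> ^ k) \<longlonglongrightarrow> 0" using c by (intro LIMSEQ_realpow_zero) simp_all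
  then have "(\<lambda>k. c * \<gamma> ^ k * vec_enorm (map_vec Re (w 0))
      + c * \<gamma> ^ k * vec_enorm (map_vec Im (w 0))) \<longlonglongrightarrow>
      c * 0 * vec_enorm (map_vec Re (w 0)) + c * 0 * vec_enorm (map_vec Im (w 0))"
    by (intro tendsto_add tendsto_mult tendsto_const)
  then have "cmod (v $ i) \<le> c * 0 * vec_enorm (map_vec Re (w 0)) + c * 0 * vec_enorm (map_vec Im (w 0))"
    using le by (intro LIMSEQ_le_const) auto
  then show False using i(2) by simp
qed

text \<open>The determinant is up to sign the product of the differences $z - a$ over the eigenvalues $a$, and
  $|z - a| \ge |z| - 1$ for each of them. The bound depends on the matrix only through its size, so it
  survives a passage to the limit.\<close>

lemma det_lower_bound:
  fixes M :: "complex mat"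
  assumes M: "M \<in> carrier_mat N N" and ev: "\<And>\<mu>. eigenvalue M \<mu> \<Longrightarrow> cmod \<mu> \<le> 1"
    and z: "cmod z > 1"
  shows "(cmod z - 1) ^ N \<le> cmod (det (M - z \<cdot>\<^sub>m 1\<^sub>m N))"
proof -
  obtain as where as: "char_poly M = (\<Prod>a\<leftarrow>as. [:- a, 1:])" "length as = N"
    using char_poly_factorized[OF M] by blast
  have p: "poly (char_poly M) z = (\<Prod>a\<leftarrow>as. z - a)" for z
    unfolding as(1) by (induction as) (auto simp: algebra_simps)
  have ev': "cmod a \<le> 1" if "a \<in> set as" for a
  proof -
    have "poly (char_poly M) a = 0" unfolding p using that by (auto simp: prod_list_zero_iff)
    then show ?thesis using ev eigenvalue_root_char_poly[OF M] by blast
  qed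
  have "(cmod z - 1) ^ length as \<le> cmod (\<Prod>a\<leftarrow>as. z - a)"
    using ev'
  proof (induction as)
    case (Cons a as)
    have "cmod z - 1 \<le> cmod (z - a)"
      using norm_triangle_ineq2[of z a] Cons.prems[of a] by simp
    then show ?case using Cons z by (auto simp: norm_mult intro!: mult_mono)
  qed simp
  also have "\<dots> = cmod (det (- (char_matrix M z)))"
    using char_poly_matrix[OF M] p by simp
  also have "\<dots> = cmod (det (M - z \<cdot>\<^sub>m 1\<^sub>m N))"
  proof -
    have "char_matrix M z = M - z \<cdot>\<^sub>m 1\<^sub>m N"
      using M by (intro eq_matI) (auto simp: char_matrix_def)
    moreover have "- (M - z \<cdot>\<^sub>m 1\<^sub>m N) = (-1) \<cdot>\<^sub>m (M - z \<cdot>\<^sub>m 1\<^sub>m N)"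
      by (intro eq_matI) auto
    ultimately show ?thesis by (simp add: det_smult norm_mult norm_power)
  qed
  finally show ?thesis unfolding as(2) .
qed

lemma eigenvalue_limit_le_1:
  assumes lim: "tends_mat N N M M0"
    and ev: "\<And>k \<mu>. eigenvalue (M k) \<mu> \<Longrightarrow> cmod \<mu> \<le> 1"
    and z: "eigenvalue M0 z"
  shows "cmod z \<le> 1"
proof (rule ccontr)
  assume "\<not> cmod z \<le> 1"
  then have z1: "cmod z > 1" by simp
  have M: "M k \<in> carrier_mat N N" "M0 \<in> carrier_mat N N" for k
    using lim by (simp_all add: tends_mat_def)
  have "tends_mat N N (\<lambda>k. M k - z \<cdot>\<^sub>m 1\<^sub>m N) (M0 - z \<cdot>\<^sub>m 1\<^sub>m N)"
    using lim by (auto simp: tends_mat_def intro!: tendsto_diff minus_carrier_mat)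
  from tendsto_norm[OF tendsto_det[OF this]]
  have "(cmod z - 1) ^ N \<le> cmod (det (M0 - z \<cdot>\<^sub>m 1\<^sub>m N))"
    by (rule LIMSEQ_le_const) (use det_lower_bound[OF M(1) ev z1] in auto)
  moreover have "0 < (cmod z - 1) ^ N" using z1 by simp
  moreover have "M0 - z \<cdot>\<^sub>m 1\<^sub>m N = char_matrix M0 z"
    using M(2) by (intro eq_matI) (auto simp: char_matrix_def)
  ultimately show False using z eigenvalue_det[OF M(2)] by simp
qed

text \<open>Expanding $|1 + h\mu|^2 \ge 1$ and dividing by $h$ gives $2\,\mathrm{Re}\,\mu + h|\mu|^2 \ge 0$.\<close>

lemma Re_nonneg_of_outside:
  assumes h: "\<And>k. h k > 0" "h \<longlonglongrightarrow> 0" and \<mu>: "\<mu> \<longlonglongrightarrow> \<mu>0"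
    and out: "\<And>k. 1 \<le> cmod (1 + complex_of_real (h k) * \<mu> k)"
  shows "0 \<le> Re \<mu>0"
proof -
  have "0 \<le> 2 * Re (\<mu> k) + h k * (cmod (\<mu> k))\<^sup>2" for k
  proof -
    have "1 \<le> (cmod (1 + complex_of_real (h k) * \<mu> k))\<^sup>2" using out[of k] by simp
    also have "\<dots> = 1 + h k * (2 * Re (\<mu> k) + h k * (cmod (\<mu> k))\<^sup>2)"
      unfolding cmod_power2 by (simp add: power2_eq_square algebra_simps)
    finally show ?thesis using h(1)[of k] by (simp add: zero_le_mult_iff)
  qed
  moreover have "(\<lambda>k. 2 * Re (\<mu> k) + h k * (cmod (\<mu> k))\<^sup>2) \<longlonglongrightarrow> 2 * Re \<mu>0 + 0 * (cmod \<mu>0)\<^sup>2"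
    by (intro tendsto_intros \<mu> h)
  ultimately have "0 \<le> 2 * Re \<mu>0 + 0 * (cmod \<mu>0)\<^sup>2" by (intro LIMSEQ_le_const) auto
  then show ?thesis by simp
qed

text \<open>Stability and instability are both proved by contradiction along such a sequence, because the limits
  of eigenvectors and of determinants are taken along sequences.\<close>

lemma vanishing_sequence:
  fixes P :: "real \<Rightarrow> bool"
  assumes "\<not> (\<exists>h0>0. \<forall>h. 0 < h \<and> h < h0 \<longrightarrow> \<not> P h)"
  obtains h where "\<And>k :: nat. h k > 0" "h \<longlonglongrightarrow> 0" "\<And>k. P (h k)"
proof -
  have "\<exists>h. 0 < h \<and> h < 1 / real (Suc k) \<and> P h" for k
    using assms by (metis of_nat_0_less_iff zero_less_Suc zero_less_divide_1_iff)
  then obtain h where h: "\<And>k. 0 < h k \<and> h k < 1 / real (Suc k) \<and> P (h k)" by metis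
  have "h \<longlonglongrightarrow> 0"
  proof (rule tendsto_sandwich[OF _ _ tendsto_const LIMSEQ_inverse_real_of_nat])
    show "\<forall>\<^sub>F k in sequentially. 0 \<le> h k" using h by (auto intro: always_eventually less_imp_le)
    show "\<forall>\<^sub>F k in sequentially. h k \<le> inverse (real (Suc k))"
      using h by (auto intro!: always_eventually less_imp_le simp: inverse_eq_divide)
  qed
  with h that show thesis by blast
qed

section \<open>The sampled loop as a perturbed Euler step\<close>

locale pid_plant =
  fixes n m p :: nat and A B C KP KI KD :: "real mat"
  assumes A: "A \<in> carrier_mat n n" and B: "B \<in> carrier_mat n m" and C: "C \<in> carrier_mat p n"
    and KP: "KP \<in> carrier_mat m p" and KI: "KI \<in> carrier_mat m p" and KD: "KD \<in> carrier_mat m p"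
begin

abbreviation sampled :: "real \<Rightarrow> real mat" where
  "sampled h \<equiv> sampled_pid_matrix A B C KP KI KD h"

text \<open>The control law with the difference quotient $d$ as an independent variable, which hides the
  factor $1/h$.\<close>

definition control :: "complex vec \<Rightarrow> complex vec \<Rightarrow> complex vec \<Rightarrow> complex vec" where
  "control x z d = - (cmat KP *\<^sub>v (cmat C *\<^sub>v x)) - cmat KI *\<^sub>v z - cmat KD *\<^sub>v d"

text \<open>The increment of $x$ over one sampling period, divided by $h$, in a state with $r = Cx - hd$.\<close>

definition rate :: "real \<Rightarrow> complex vec \<Rightarrow> complex vec \<Rightarrow> complex vec \<Rightarrow> complex vec" where
  "rate h x z d = cmat ((1 / h) \<cdot>\<^sub>m (Phi A h - 1\<^sub>m n)) *\<^sub>v x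
     + cmat ((1 / h) \<cdot>\<^sub>m Gam A h) *\<^sub>v (cmat B *\<^sub>v control x z d)"

lemma C_mult_carrier: "x \<in> carrier_vec n \<Longrightarrow> cmat C *\<^sub>v x \<in> carrier_vec p"
  and B_mult_carrier: "u \<in> carrier_vec m \<Longrightarrow> cmat B *\<^sub>v u \<in> carrier_vec n"
  and KP_mult_carrier: "y \<in> carrier_vec p \<Longrightarrow> cmat KP *\<^sub>v y \<in> carrier_vec m"
  and KI_mult_carrier: "y \<in> carrier_vec p \<Longrightarrow> cmat KI *\<^sub>v y \<in> carrier_vec m"
  and KD_mult_carrier: "y \<in> carrier_vec p \<Longrightarrow> cmat KD *\<^sub>v y \<in> carrier_vec m"
  and Phi_mult_carrier: "x \<in> carrier_vec n \<Longrightarrow> cmat (Phi A h) *\<^sub>v x \<in> carrier_vec n"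
  and Gam_mult_carrier: "x \<in> carrier_vec n \<Longrightarrow> cmat (Gam A h) *\<^sub>v x \<in> carrier_vec n"
  and A_mult_carrier: "x \<in> carrier_vec n \<Longrightarrow> cmat A *\<^sub>v x \<in> carrier_vec n"
  using A B C KP KI KD Phi_carrier[OF A, of h] Gam_carrier[OF A, of h]
  by (auto intro!: mult_mat_vec_carrier)

lemma control_carrier:
  "x \<in> carrier_vec n \<Longrightarrow> z \<in> carrier_vec p \<Longrightarrow> d \<in> carrier_vec p \<Longrightarrow> control x z d \<in> carrier_vec m"
  unfolding control_def by (intro minus_carrier_vec uminus_carrier_vec[THEN iffD2]
      KP_mult_carrier KI_mult_carrier KD_mult_carrier C_mult_carrier)

lemma sampled_carrier: "sampled h \<in> carrier_mat (n + (p + p)) (n + (p + p))"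
  using A B C KP KI KD Phi_carrier[OF A, of h] Gam_carrier[OF A, of h]
  by (auto simp: sampled_pid_matrix_def Let_def intro!: four_block_carrier_mat minus_carrier_mat)

lemma map_vec_lin:
  fixes f :: "complex \<Rightarrow> real"
  assumes f: "f = Re \<or> f = Im"
  shows "map_vec f (v @\<^sub>v w) = map_vec f v @\<^sub>v map_vec f w"
    "v \<in> carrier_vec k \<Longrightarrow> w \<in> carrier_vec k \<Longrightarrow> map_vec f (v + w) = map_vec f v + map_vec f w"
    "v \<in> carrier_vec k \<Longrightarrow> w \<in> carrier_vec k \<Longrightarrow> map_vec f (v - w) = map_vec f v - map_vec f w"
    "map_vec f (- v) = - map_vec f v"
    "map_vec f (complex_of_real a \<cdot>\<^sub>v v) = a \<cdot>\<^sub>v map_vec f v"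
    "M \<in> carrier_mat r k \<Longrightarrow> v \<in> carrier_vec k \<Longrightarrow> map_vec f (cmat M *\<^sub>v v) = M *\<^sub>v map_vec f v"
  using f by (auto intro!: eq_vecI simp: Re_cmat_mult_vec Im_cmat_mult_vec)

text \<open>The real and the imaginary part of a complex state evolve independently, each by the real update.\<close>

lemma sampled_update_complex:
  assumes x: "x \<in> carrier_vec n" and z: "z \<in> carrier_vec p" and r: "r \<in> carrier_vec p"
    and d_def: "d = complex_of_real (1 / h) \<cdot>\<^sub>v (cmat C *\<^sub>v x - r)"
  shows "cmat (sampled h) *\<^sub>v (x @\<^sub>v (z @\<^sub>v r)) =
    (cmat (Phi A h) *\<^sub>v x + cmat (Gam A h) *\<^sub>v (cmat B *\<^sub>v control x z d)) @\<^sub>v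
    ((z + complex_of_real h \<cdot>\<^sub>v (cmat C *\<^sub>v x)) @\<^sub>v (cmat C *\<^sub>v x))"
    (is "?l = ?r")
proof -
  have d: "d \<in> carrier_vec p" using x r by (simp add: d_def C_mult_carrier)
  have "map_vec f ?l = map_vec f ?r" if f: "f = Re \<or> f = Im" for f
  proof -
    note lin = map_vec_lin[OF f]
    have fx: "map_vec f x \<in> carrier_vec n" "map_vec f z \<in> carrier_vec p" "map_vec f r \<in> carrier_vec p"
      using x z r by simp_all
    have "map_vec f ?l = sampled h *\<^sub>v (map_vec f x @\<^sub>v (map_vec f z @\<^sub>v map_vec f r))"
      using x z r by (simp add: lin(6)[OF sampled_carrier] lin(1))
    also have "\<dots> = (Phi A h *\<^sub>v map_vec f x + Gam A h *\<^sub>v (B *\<^sub>v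
          (- (KP *\<^sub>v (C *\<^sub>v map_vec f x)) - KI *\<^sub>v map_vec f z
           - KD *\<^sub>v ((1 / h) \<cdot>\<^sub>v (C *\<^sub>v map_vec f x - map_vec f r))))) @\<^sub>v
        ((map_vec f z + h \<cdot>\<^sub>v (C *\<^sub>v map_vec f x)) @\<^sub>v (C *\<^sub>v map_vec f x))"
      by (rule sampled_pid_matrix_update[OF A B C KP KI KD fx refl])
    also have "- (KP *\<^sub>v (C *\<^sub>v map_vec f x)) - KI *\<^sub>v map_vec f z
           - KD *\<^sub>v ((1 / h) \<cdot>\<^sub>v (C *\<^sub>v map_vec f x - map_vec f r)) = map_vec f (control x z d)"
    proof -
      have "map_vec f d = (1 / h) \<cdot>\<^sub>v (C *\<^sub>v map_vec f x - map_vec f r)"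
        unfolding d_def lin(5) lin(3)[OF C_mult_carrier[OF x] r] lin(6)[OF C x] ..
      moreover have "- (cmat KP *\<^sub>v (cmat C *\<^sub>v x)) \<in> carrier_vec m"
        "- (cmat KP *\<^sub>v (cmat C *\<^sub>v x)) - cmat KI *\<^sub>v z \<in> carrier_vec m"
        using KP_mult_carrier[OF C_mult_carrier[OF x]] KI_mult_carrier[OF z] by (simp_all add: minus_carrier_vec)
      ultimately show ?thesis
        unfolding control_def
        by (simp add: lin(3)[of _ m] lin(4) lin(6)[OF KP C_mult_carrier[OF x]] lin(6)[OF C x] lin(6)[OF KI z]
            lin(6)[OF KD d] KI_mult_carrier[OF z] KD_mult_carrier[OF d])
    qed
    also have "(Phi A h *\<^sub>v map_vec f x + Gam A h *\<^sub>v (B *\<^sub>v map_vec f (control x z d))) @\<^sub>v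
        ((map_vec f z + h \<cdot>\<^sub>v (C *\<^sub>v map_vec f x)) @\<^sub>v (C *\<^sub>v map_vec f x)) = map_vec f ?r"
    proof -
      note u = control_carrier[OF x z d]
      have hC: "complex_of_real h \<cdot>\<^sub>v (cmat C *\<^sub>v x) \<in> carrier_vec p" using C_mult_carrier[OF x] by simp
      show ?thesis
        unfolding lin(1) lin(2)[OF Phi_mult_carrier[OF x] Gam_mult_carrier[OF B_mult_carrier[OF u]]] lin(6)[OF Phi_carrier[OF A] x]
          lin(6)[OF Gam_carrier[OF A] B_mult_carrier[OF u]] lin(6)[OF B u] lin(2)[OF z hC] lin(5) lin(6)[OF C x] ..
    qed
    finally show ?thesis .
  qed
  then show ?thesis by (intro complex_vec_eqI) auto
qed

lemma rate_carrier:
  assumes "x \<in> carrier_vec n" "z \<in> carrier_vec p" "d \<in> carrier_vec p"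
  shows "rate h x z d \<in> carrier_vec n"
  unfolding rate_def
  by (intro add_carrier_vec mult_mat_vec_carrier[of _ n n] B_mult_carrier control_carrier assms)
    (simp_all add: Gam_carrier[OF A] minus_carrier_mat)

text \<open>The point of replacing $r$ by $Cx - hd$ is that the terms of order $1/h$ disappear from the update.\<close>

lemma sampled_step:
  assumes x: "x \<in> carrier_vec n" and z: "z \<in> carrier_vec p" and d: "d \<in> carrier_vec p"
    and h: "h > 0"
  shows "cmat (sampled h) *\<^sub>v (x @\<^sub>v (z @\<^sub>v (cmat C *\<^sub>v x - complex_of_real h \<cdot>\<^sub>v d))) =
    (x + complex_of_real h \<cdot>\<^sub>v rate h x z d) @\<^sub>v
    ((z + complex_of_real h \<cdot>\<^sub>v (cmat C *\<^sub>v x)) @\<^sub>v (cmat C *\<^sub>v x))"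
proof -
  let ?c = "complex_of_real"
  have r: "cmat C *\<^sub>v x - ?c h \<cdot>\<^sub>v d \<in> carrier_vec p" using C_mult_carrier[OF x] d by simp
  have dd: "?c (1 / h) \<cdot>\<^sub>v (cmat C *\<^sub>v x - (cmat C *\<^sub>v x - ?c h \<cdot>\<^sub>v d)) = d"
    by (rule eq_vecI) (use C_mult_carrier[OF x] d h in auto)
  note w = B_mult_carrier[OF control_carrier[OF x z d]]
  have "cmat (Phi A h) *\<^sub>v x = x + ?c h \<cdot>\<^sub>v (cmat ((1 / h) \<cdot>\<^sub>m (Phi A h - 1\<^sub>m n)) *\<^sub>v x)"
  proof -
    have "cmat ((1 / h) \<cdot>\<^sub>m (Phi A h - 1\<^sub>m n)) = ?c (1 / h) \<cdot>\<^sub>m (cmat (Phi A h) - 1\<^sub>m n)"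
      using Phi_carrier[OF A, of h] by (intro eq_matI) auto
    also have "\<dots> *\<^sub>v x = ?c (1 / h) \<cdot>\<^sub>v (cmat (Phi A h) *\<^sub>v x - x)"
      using Phi_carrier[OF A, of h] x
      by (simp add: smult_mat_mult_vec[of _ n n] minus_mult_distrib_mat_vec[of _ n n] minus_carrier_mat)
    finally show ?thesis
      using carrier_vecD[OF Phi_mult_carrier[OF x, of h]] carrier_matD[OF Phi_carrier[OF A, of h]] x h
      by (intro eq_vecI) auto
  qed
  moreover have "cmat (Gam A h) *\<^sub>v (cmat B *\<^sub>v control x z d) =
      ?c h \<cdot>\<^sub>v (cmat ((1 / h) \<cdot>\<^sub>m Gam A h) *\<^sub>v (cmat B *\<^sub>v control x z d))"
  proof -
    have "cmat ((1 / h) \<cdot>\<^sub>m Gam A h) = ?c (1 / h) \<cdot>\<^sub>m cmat (Gam A h)"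
      using Gam_carrier[OF A, of h] by (intro eq_matI) auto
    then show ?thesis
      using Gam_carrier[OF A, of h] w h by (simp add: smult_mat_mult_vec[of _ n n] smult_smult_assoc)
  qed
  moreover have "cmat ((1 / h) \<cdot>\<^sub>m (Phi A h - 1\<^sub>m n)) *\<^sub>v x \<in> carrier_vec n"
    "cmat ((1 / h) \<cdot>\<^sub>m Gam A h) *\<^sub>v (cmat B *\<^sub>v control x z d) \<in> carrier_vec n"
    using x w Gam_carrier[OF A, of h]
    by (auto intro!: mult_mat_vec_carrier[of _ n n] minus_carrier_mat)
  ultimately have "cmat (Phi A h) *\<^sub>v x + cmat (Gam A h) *\<^sub>v (cmat B *\<^sub>v control x z d)
      = x + ?c h \<cdot>\<^sub>v rate h x z d"
    unfolding rate_def using x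
    by (simp add: smult_add_distrib_vec[of _ n] assoc_add_vec[of _ n])
  then show ?thesis using sampled_update_complex[OF x z r dd[symmetric]] by simp
qed

lemma tends_const_mult:
  "M \<in> carrier_mat r c \<Longrightarrow> tends_vec c v v0 \<Longrightarrow> tends_vec r (\<lambda>k. cmat M *\<^sub>v v k) (cmat M *\<^sub>v v0)"
  by (rule tends_vec_mult_mat[OF tends_mat_const]) simp_all

lemmas tends_plant =
  tends_const_mult[OF B] tends_const_mult[OF C]
  tends_const_mult[OF KP] tends_const_mult[OF KI] tends_const_mult[OF KD]

lemma tends_control:
  assumes "tends_vec n x x0" "tends_vec p z z0" "tends_vec p d d0"
  shows "tends_vec m (\<lambda>k. control (x k) (z k) (d k)) (control x0 z0 d0)"
  unfolding control_def
  by (intro tends_vec_minus tends_vec_uminus tends_plant assms)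

text \<open>In the limit the rate is the right-hand side of the plant equation $\dot x = Ax + Bu$.\<close>

lemma tends_rate:
  assumes h: "\<And>k. h k > 0" "h \<longlonglongrightarrow> 0"
    and "tends_vec n x x0" "tends_vec p z z0" "tends_vec p d d0"
  shows "tends_vec n (\<lambda>k. rate (h k) (x k) (z k) (d k)) (cmat A *\<^sub>v x0 + cmat B *\<^sub>v control x0 z0 d0)"
proof -
  have "tends_vec n (\<lambda>k. rate (h k) (x k) (z k) (d k))
      (cmat A *\<^sub>v x0 + 1\<^sub>m n *\<^sub>v (cmat B *\<^sub>v control x0 z0 d0))"
    unfolding rate_def
    by (intro tends_vec_add tends_vec_mult_mat[OF Phi_quotient_tendsto[OF A h]]
        tends_vec_mult_mat[OF Gam_quotient_tendsto[OF A h]] tends_plant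
        tends_control assms)
  moreover have "cmat B *\<^sub>v control x0 z0 d0 \<in> carrier_vec n"
    by (intro B_mult_carrier control_carrier) (use assms in \<open>simp_all add: tends_vec_def\<close>)
  ultimately show ?thesis by simp
qed

section \<open>The fast modes\<close>

text \<open>Here the offset $e = Cx - r$ is kept fixed, so $d = e/h$ blows up; but it enters the new state only
  through $h\,u$, where the factor $h$ compensates. Hence the sampled matrix itself has a limit as
  $h \to 0$, although its formula contains $1/h$.\<close>

lemma sampled_limit:
  assumes h: "\<And>k. h k > 0" "h \<longlonglongrightarrow> 0"
    and x: "x \<in> carrier_vec n" and z: "z \<in> carrier_vec p" and e: "e \<in> carrier_vec p"
  shows "tends_vec (n + (p + p)) (\<lambda>k. cmat (sampled (h k)) *\<^sub>v (x @\<^sub>v (z @\<^sub>v (cmat C *\<^sub>v x - e))))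
    ((x - cmat B *\<^sub>v (cmat KD *\<^sub>v e)) @\<^sub>v (z @\<^sub>v (cmat C *\<^sub>v x)))"
proof -
  let ?c = "complex_of_real"
  have ch: "(\<lambda>k. ?c (h k)) \<longlonglongrightarrow> 0" using tendsto_of_real[OF h(2), where 'a = complex] by simp
  define u where "u k = ?c (h k) \<cdot>\<^sub>v control x z (0\<^sub>v p) - cmat KD *\<^sub>v e" for k
  have cx: "control x z (0\<^sub>v p) \<in> carrier_vec m" by (rule control_carrier[OF x z]) simp
  have Ke: "cmat KD *\<^sub>v e \<in> carrier_vec m" by (rule KD_mult_carrier[OF e])
  have eq: "cmat (sampled (h k)) *\<^sub>v (x @\<^sub>v (z @\<^sub>v (cmat C *\<^sub>v x - e))) =
      (x + (?c (h k) \<cdot>\<^sub>v (cmat ((1 / h k) \<cdot>\<^sub>m (Phi A (h k) - 1\<^sub>m n)) *\<^sub>v x) +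
        cmat ((1 / h k) \<cdot>\<^sub>m Gam A (h k)) *\<^sub>v (cmat B *\<^sub>v u k))) @\<^sub>v
      ((z + ?c (h k) \<cdot>\<^sub>v (cmat C *\<^sub>v x)) @\<^sub>v (cmat C *\<^sub>v x))" for k
  proof -
    define d where "d = ?c (1 / h k) \<cdot>\<^sub>v e"
    have d: "d \<in> carrier_vec p" using e by (simp add: d_def)
    have hd: "?c (h k) \<cdot>\<^sub>v d = e" using h(1)[of k] by (simp add: d_def smult_smult_assoc)
    have "?c (h k) \<cdot>\<^sub>v control x z d = u k"
    proof -
      have alg: "t \<cdot>\<^sub>v (- a - b - w) = t \<cdot>\<^sub>v (- a - b - 0\<^sub>v m) - t \<cdot>\<^sub>v w"
        if "a \<in> carrier_vec m" "b \<in> carrier_vec m" "w \<in> carrier_vec m" for t and a b w :: "complex vec"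
        by (rule eq_vecI) (use that in \<open>auto simp: algebra_simps\<close>)
      have "cmat KD *\<^sub>v e = ?c (h k) \<cdot>\<^sub>v (cmat KD *\<^sub>v d)"
        unfolding hd[symmetric] by (rule mult_mat_vec[of _ m p]) (use KD d in simp_all)
      moreover have "cmat KD *\<^sub>v 0\<^sub>v p = 0\<^sub>v m" using KD by (intro eq_vecI) auto
      ultimately show ?thesis
        unfolding u_def control_def using alg[OF KP_mult_carrier[OF C_mult_carrier[OF x]] KI_mult_carrier[OF z] KD_mult_carrier[OF d]] by simp
    qed
    moreover have "?c (h k) \<cdot>\<^sub>v rate (h k) x z d =
        ?c (h k) \<cdot>\<^sub>v (cmat ((1 / h k) \<cdot>\<^sub>m (Phi A (h k) - 1\<^sub>m n)) *\<^sub>v x) +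
        cmat ((1 / h k) \<cdot>\<^sub>m Gam A (h k)) *\<^sub>v (cmat B *\<^sub>v (?c (h k) \<cdot>\<^sub>v control x z d))"
    proof -
      have "cmat ((1 / h k) \<cdot>\<^sub>m (Phi A (h k) - 1\<^sub>m n)) *\<^sub>v x \<in> carrier_vec n"
        "cmat ((1 / h k) \<cdot>\<^sub>m Gam A (h k)) *\<^sub>v (cmat B *\<^sub>v control x z d) \<in> carrier_vec n"
        using x B_mult_carrier[OF control_carrier[OF x z d]] Gam_carrier[OF A, of "h k"]
        by (auto intro!: mult_mat_vec_carrier[of _ n n] minus_carrier_mat)
      moreover have "cmat B *\<^sub>v (?c (h k) \<cdot>\<^sub>v control x z d) = ?c (h k) \<cdot>\<^sub>v (cmat B *\<^sub>v control x z d)"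
        by (rule mult_mat_vec[of _ n m]) (use B control_carrier[OF x z d] in simp_all)
      moreover have "cmat ((1 / h k) \<cdot>\<^sub>m Gam A (h k)) *\<^sub>v (?c (h k) \<cdot>\<^sub>v (cmat B *\<^sub>v control x z d)) =
          ?c (h k) \<cdot>\<^sub>v (cmat ((1 / h k) \<cdot>\<^sub>m Gam A (h k)) *\<^sub>v (cmat B *\<^sub>v control x z d))"
        by (rule mult_mat_vec[of _ n n])
          (use Gam_carrier[OF A] B_mult_carrier[OF control_carrier[OF x z d]] in simp_all)
      ultimately show ?thesis unfolding rate_def by (simp add: smult_add_distrib_vec[of _ n])
    qed
    ultimately show ?thesis using sampled_step[OF x z d h(1)[of k]] unfolding hd by simp
  qed
  have "tends_vec m u (0 \<cdot>\<^sub>v control x z (0\<^sub>v p) - cmat KD *\<^sub>v e)"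
    unfolding u_def[abs_def]
    by (intro tends_vec_minus tends_vec_smult ch tends_vec_const cx Ke)
  moreover have "0 \<cdot>\<^sub>v control x z (0\<^sub>v p) - cmat KD *\<^sub>v e = - (cmat KD *\<^sub>v e)"
    using carrier_vecD[OF cx] carrier_vecD[OF Ke]
    by (intro eq_vecI) (simp_all del: index_mult_mat_vec)
  ultimately have u: "tends_vec m u (- (cmat KD *\<^sub>v e))" by simp
  have "tends_vec (n + (p + p)) (\<lambda>k. cmat (sampled (h k)) *\<^sub>v (x @\<^sub>v (z @\<^sub>v (cmat C *\<^sub>v x - e))))
    ((x + (0 \<cdot>\<^sub>v (cmat A *\<^sub>v x) + 1\<^sub>m n *\<^sub>v (cmat B *\<^sub>v (- (cmat KD *\<^sub>v e))))) @\<^sub>v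
      ((z + 0 \<cdot>\<^sub>v (cmat C *\<^sub>v x)) @\<^sub>v (cmat C *\<^sub>v x)))"
    unfolding eq
    by (intro tends_vec_append tends_vec_add tends_vec_smult ch u
        tends_vec_mult_mat[OF Phi_quotient_tendsto[OF A h]]
        tends_vec_mult_mat[OF Gam_quotient_tendsto[OF A h]]
        tends_plant tends_vec_const C_mult_carrier x z)
  moreover have "x + (0 \<cdot>\<^sub>v (cmat A *\<^sub>v x) + 1\<^sub>m n *\<^sub>v (cmat B *\<^sub>v (- (cmat KD *\<^sub>v e))))
      = x - cmat B *\<^sub>v (cmat KD *\<^sub>v e)"
  proof -
    have "cmat B *\<^sub>v (- (cmat KD *\<^sub>v e)) = - (cmat B *\<^sub>v (cmat KD *\<^sub>v e))"
      by (rule mult_mat_uminus_vec[of _ n m]) (use B Ke in simp_all)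
    then show ?thesis
      using B_mult_carrier[OF Ke] by (simp add: smult_0_vec[OF A_mult_carrier[OF x]] minus_add_uminus_vec[OF x])
  qed
  moreover have "z + 0 \<cdot>\<^sub>v (cmat C *\<^sub>v x) = z" using z by (simp add: smult_0_vec[OF C_mult_carrier[OF x]])
  ultimately show ?thesis by simp
qed

text \<open>If $M_D e = \mu e$ with $\mu \ne -1$, then the limit of the sampled matrices has the eigenvalue $-\mu$, with the
  eigenvector $(x, 0, r)$ for $x = BK_D e/(1 + \mu)$ and $r = Cx - e = -e/(1 + \mu)$.\<close>

lemma fast_eigenvalues_bounded:
  assumes h: "\<And>k. h k > 0" "h \<longlonglongrightarrow> 0"
    and st: "\<And>k. dt_exponentially_stable (sampled (h k))"
    and \<mu>: "eigenvalue (cmat (C * B * KD)) \<mu>"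
  shows "cmod \<mu> \<le> 1"
proof (rule ccontr)
  assume "\<not> cmod \<mu> \<le> 1"
  moreover have "\<mu> = - 1" if "1 + \<mu> = 0" using that by (simp add: add_eq_0_iff)
  ultimately have mu: "\<mu> \<noteq> 0" "1 + \<mu> \<noteq> 0" by auto
  let ?N = "n + (p + p)"
  let ?M = "\<lambda>k. cmat (sampled (h k))"
  have M: "?M k \<in> carrier_mat ?N ?N" for k using sampled_carrier by simp
  have "\<exists>v0. tends_vec ?N (\<lambda>k. ?M k *\<^sub>v v) v0" if v: "v \<in> carrier_vec ?N" for v
  proof -
    define x where "x = vec_first v n"
    define z where "z = vec_first (vec_last v (p + p)) p"
    define r where "r = vec_last (vec_last v (p + p)) p"
    have c: "x \<in> carrier_vec n" "z \<in> carrier_vec p" "r \<in> carrier_vec p"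
      by (simp_all add: x_def z_def r_def)
    have "v = x @\<^sub>v (z @\<^sub>v r)"
      using v by (simp add: x_def z_def r_def vec_first_last_append[of _ n "p + p"]
          vec_first_last_append[of _ p p])
    moreover have "r = cmat C *\<^sub>v x - (cmat C *\<^sub>v x - r)"
      using c C_mult_carrier[OF c(1)] by (intro eq_vecI) auto
    ultimately show ?thesis
      using sampled_limit[OF h c(1,2), of "cmat C *\<^sub>v x - r"] c C_mult_carrier[OF c(1)]
      by (auto simp: minus_carrier_vec)
  qed
  then obtain M0 where M0: "tends_mat ?N ?N ?M M0"
    using tends_mat_if_columns_converge[of ?M ?N] M by blast
  obtain e where e: "e \<in> carrier_vec p" "e \<noteq> 0\<^sub>v p" "cmat (C * B * KD) *\<^sub>v e = \<mu> \<cdot>\<^sub>v e"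
    using \<mu> C KD by (auto simp: eigenvalue_def eigenvector_def)
  define b where "b = cmat B *\<^sub>v (cmat KD *\<^sub>v e)"
  have b: "b \<in> carrier_vec n" unfolding b_def by (intro B_mult_carrier KD_mult_carrier e)
  have Cb: "cmat C *\<^sub>v b = \<mu> \<cdot>\<^sub>v e"
    using e(3) unfolding b_def cmat_mult_vec[OF mult_carrier_mat[OF C B] KD e(1)]
      cmat_mult_vec[OF C B KD_mult_carrier[OF e(1)]] .
  define x where "x = (1 / (1 + \<mu>)) \<cdot>\<^sub>v b"
  have x: "x \<in> carrier_vec n" using b by (simp add: x_def)
  have Cx: "cmat C *\<^sub>v x = (\<mu> / (1 + \<mu>)) \<cdot>\<^sub>v e"
    using mult_mat_vec[of "cmat C" p n b] C b by (simp add: x_def Cb smult_smult_assoc)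
  define r where "r = (- 1 / (1 + \<mu>)) \<cdot>\<^sub>v e"
  have r: "r \<in> carrier_vec p" using e(1) by (simp add: r_def)
  have re: "cmat C *\<^sub>v x - e = r"
    using e(1) mu(2) unfolding Cx r_def by (intro eq_vecI) (auto simp: field_simps)
  define v where "v = x @\<^sub>v (0\<^sub>v p @\<^sub>v r)"
  have v: "v \<in> carrier_vec ?N" unfolding v_def by (intro append_carrier_vec x r) simp
  have "tends_vec ?N (\<lambda>k. ?M k *\<^sub>v v) ((x - b) @\<^sub>v (0\<^sub>v p @\<^sub>v (cmat C *\<^sub>v x)))"
    using sampled_limit[OF h x _ e(1), of "0\<^sub>v p"] unfolding re v_def b_def by simp
  moreover have "tends_vec ?N (\<lambda>k. ?M k *\<^sub>v v) (M0 *\<^sub>v v)"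
    by (intro tends_vec_mult_mat[OF M0] tends_vec_const v)
  ultimately have "M0 *\<^sub>v v = (x - b) @\<^sub>v (0\<^sub>v p @\<^sub>v (cmat C *\<^sub>v x))"
    using tends_vec_unique by blast
  also have "x - b = (- \<mu>) \<cdot>\<^sub>v x"
    using b mu(2) unfolding x_def by (intro eq_vecI) (auto simp: field_simps)
  also have "cmat C *\<^sub>v x = (- \<mu>) \<cdot>\<^sub>v r"
    using e(1) unfolding Cx r_def by (intro eq_vecI) auto
  also have "((- \<mu>) \<cdot>\<^sub>v x) @\<^sub>v (0\<^sub>v p @\<^sub>v ((- \<mu>) \<cdot>\<^sub>v r)) = (- \<mu>) \<cdot>\<^sub>v v"
    unfolding v_def using x r by (intro eq_vecI) auto
  finally have "M0 *\<^sub>v v = (- \<mu>) \<cdot>\<^sub>v v" .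
  moreover have "v \<noteq> 0\<^sub>v ?N"
  proof
    assume v0: "v = 0\<^sub>v ?N"
    obtain i where i: "i < p" "e $ i \<noteq> 0"
      using e(1,2) by (metis carrier_vecD eq_vecI index_zero_vec)
    have "v $ (n + (p + i)) = r $ i" unfolding v_def using x r i by simp
    then show False using v0 i e(1) mu by (simp add: r_def)
  qed
  ultimately have "eigenvalue M0 (- \<mu>)"
    using v M0 by (auto simp: eigenvalue_def eigenvector_def tends_mat_def)
  moreover have "cmod \<nu> \<le> 1" if "eigenvalue (?M k) \<nu>" for k \<nu>
    using eigenvalues_if_exponentially_stable[OF sampled_carrier st that] by simp
  ultimately have "cmod (- \<mu>) \<le> 1" using eigenvalue_limit_le_1[OF M0] by blast
  then show False using \<open>\<not> cmod \<mu> \<le> 1\<close> by simp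
qed

section \<open>The slow modes\<close>

text \<open>The eigenvalue equation in the coordinates $(x, z, d)$. The first two equations and the last one
  are divided by $l$, because $1/l$ is bounded for $|l| \ge 1$ whereas $l$ itself has no obvious bound;
  so limits can be taken in them. The other two describe the slow motion with exponent $\mu$.\<close>

lemma eigenvector_equations:
  assumes x: "x \<in> carrier_vec n" and z: "z \<in> carrier_vec p" and d: "d \<in> carrier_vec p"
    and h: "h > 0" and l0: "l \<noteq> 0"
    and ev: "cmat (sampled h) *\<^sub>v (x @\<^sub>v (z @\<^sub>v (cmat C *\<^sub>v x - complex_of_real h \<cdot>\<^sub>v d)))
      = l \<cdot>\<^sub>v (x @\<^sub>v (z @\<^sub>v (cmat C *\<^sub>v x - complex_of_real h \<cdot>\<^sub>v d)))"
  defines "\<mu> \<equiv> (l - 1) / complex_of_real h"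
  shows "x = (1 / l) \<cdot>\<^sub>v (x + complex_of_real h \<cdot>\<^sub>v rate h x z d)"
    and "z = (1 / l) \<cdot>\<^sub>v (z + complex_of_real h \<cdot>\<^sub>v (cmat C *\<^sub>v x))"
    and "\<mu> \<cdot>\<^sub>v x = rate h x z d"
    and "\<mu> \<cdot>\<^sub>v z = cmat C *\<^sub>v x"
    and "d = (1 / l) \<cdot>\<^sub>v (cmat C *\<^sub>v rate h x z d)"
proof -
  let ?c = "complex_of_real h"
  note F = rate_carrier[OF x z d, of h]
  have h0: "?c \<noteq> 0" using h by simp
  have app: "l \<cdot>\<^sub>v (v @\<^sub>v w) = (l \<cdot>\<^sub>v v) @\<^sub>v (l \<cdot>\<^sub>v w)" for v w :: "complex vec"
    by (rule eq_vecI) auto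
  have "(x + ?c \<cdot>\<^sub>v rate h x z d) @\<^sub>v ((z + ?c \<cdot>\<^sub>v (cmat C *\<^sub>v x)) @\<^sub>v (cmat C *\<^sub>v x)) =
      (l \<cdot>\<^sub>v x) @\<^sub>v ((l \<cdot>\<^sub>v z) @\<^sub>v (l \<cdot>\<^sub>v (cmat C *\<^sub>v x - ?c \<cdot>\<^sub>v d)))"
    using ev unfolding sampled_step[OF x z d h] app .
  then have eqs: "x + ?c \<cdot>\<^sub>v rate h x z d = l \<cdot>\<^sub>v x" "z + ?c \<cdot>\<^sub>v (cmat C *\<^sub>v x) = l \<cdot>\<^sub>v z"
    "cmat C *\<^sub>v x = l \<cdot>\<^sub>v (cmat C *\<^sub>v x - ?c \<cdot>\<^sub>v d)"
    using append_vec_eq[of "x + ?c \<cdot>\<^sub>v rate h x z d" n "l \<cdot>\<^sub>v x"]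
      append_vec_eq[of "z + ?c \<cdot>\<^sub>v (cmat C *\<^sub>v x)" p "l \<cdot>\<^sub>v z"] x z F C_mult_carrier[OF x] by auto
  show "x = (1 / l) \<cdot>\<^sub>v (x + ?c \<cdot>\<^sub>v rate h x z d)" "z = (1 / l) \<cdot>\<^sub>v (z + ?c \<cdot>\<^sub>v (cmat C *\<^sub>v x))"
    unfolding eqs(1,2) using l0 by (simp_all add: smult_smult_assoc)
  show mx: "\<mu> \<cdot>\<^sub>v x = rate h x z d"
  proof (rule eq_vecI)
    fix i assume "i < dim_vec (rate h x z d)"
    then have i: "i < n" using F by simp
    have "(x + ?c \<cdot>\<^sub>v rate h x z d) $ i = (l \<cdot>\<^sub>v x) $ i" using eqs(1) by simp
    then have "x $ i + ?c * rate h x z d $ i = l * x $ i" using i x F by simp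
    then show "(\<mu> \<cdot>\<^sub>v x) $ i = rate h x z d $ i" using i x h0 by (simp add: \<mu>_def field_simps)
  qed (use x F in simp)
  show "\<mu> \<cdot>\<^sub>v z = cmat C *\<^sub>v x"
  proof (rule eq_vecI)
    fix i assume "i < dim_vec (cmat C *\<^sub>v x)"
    then have i: "i < p" using carrier_vecD[OF C_mult_carrier[OF x]] by simp
    have "(z + ?c \<cdot>\<^sub>v (cmat C *\<^sub>v x)) $ i = (l \<cdot>\<^sub>v z) $ i" using eqs(2) by simp
    then have "z $ i + ?c * (cmat C *\<^sub>v x) $ i = l * z $ i"
      using i z carrier_vecD[OF C_mult_carrier[OF x]] by (simp del: index_mult_mat_vec)
    then show "(\<mu> \<cdot>\<^sub>v z) $ i = (cmat C *\<^sub>v x) $ i"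
      using i z h0 by (simp add: \<mu>_def field_simps del: index_mult_mat_vec)
  qed (use z C in simp)
  have "d = (1 / l) \<cdot>\<^sub>v (\<mu> \<cdot>\<^sub>v (cmat C *\<^sub>v x))"
  proof (rule eq_vecI)
    have Cx: "dim_vec (cmat C *\<^sub>v x) = p" using C_mult_carrier[OF x] by (rule carrier_vecD)
    show "dim_vec d = dim_vec ((1 / l) \<cdot>\<^sub>v (\<mu> \<cdot>\<^sub>v (cmat C *\<^sub>v x)))" using d C by simp
    fix i assume "i < dim_vec ((1 / l) \<cdot>\<^sub>v (\<mu> \<cdot>\<^sub>v (cmat C *\<^sub>v x)))"
    then have i: "i < p" using Cx by simp
    have "(cmat C *\<^sub>v x) $ i = (l \<cdot>\<^sub>v (cmat C *\<^sub>v x - ?c \<cdot>\<^sub>v d)) $ i" using eqs(3) by simp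
    then have "(cmat C *\<^sub>v x) $ i = l * ((cmat C *\<^sub>v x) $ i - ?c * d $ i)"
      using i d Cx by (simp del: index_mult_mat_vec)
    then show "d $ i = ((1 / l) \<cdot>\<^sub>v (\<mu> \<cdot>\<^sub>v (cmat C *\<^sub>v x))) $ i"
      using i d Cx h0 l0 by (simp add: \<mu>_def field_simps del: index_mult_mat_vec)
  qed
  also have "\<mu> \<cdot>\<^sub>v (cmat C *\<^sub>v x) = cmat C *\<^sub>v rate h x z d"
    unfolding mx[symmetric] by (rule mult_mat_vec[of _ p n, symmetric]) (use C x in simp_all)
  finally show "d = (1 / l) \<cdot>\<^sub>v (cmat C *\<^sub>v rate h x z d)" .
qed

text \<open>With $d = \mu Cx$ the plant equation becomes $(I + BK_DC)\,\mu x = (A - BK_PC)x - BK_Iz$; it remains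
  to multiply by the inverse of $I + BK_DC$.\<close>

lemma ideal_eigenvalue:
  assumes inv: "invertible_mat (1\<^sub>m n + B * KD * C)"
    and x: "x \<in> carrier_vec n" and z: "z \<in> carrier_vec p" and d: "d \<in> carrier_vec p"
    and nz: "x \<noteq> 0\<^sub>v n \<or> z \<noteq> 0\<^sub>v p"
    and mx: "\<mu> \<cdot>\<^sub>v x = cmat A *\<^sub>v x + cmat B *\<^sub>v control x z d"
    and mz: "\<mu> \<cdot>\<^sub>v z = cmat C *\<^sub>v x"
    and md: "d = \<mu> \<cdot>\<^sub>v (cmat C *\<^sub>v x)"
  shows "eigenvalue (cmat (ideal_pid_matrix A B C KP KI KD)) \<mu>"
proof -
  let ?E = "1\<^sub>m n + B * KD * C"
  have E: "?E \<in> carrier_mat n n" using B KD C by simp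
  \<comment> \<open>A matrix has no \<^const>\<open>mat_inverse\<close> only if it is not a unit of the matrix ring.\<close>
  obtain V where V: "mat_inverse ?E = Some V"
  proof (cases "mat_inverse ?E")
    case None
    have "?E \<in> Units (ring_mat TYPE(real) n ())"
    proof -
      obtain W where W: "inverts_mat ?E W" "inverts_mat W ?E"
        using inv by (auto simp: invertible_mat_def)
      have EW: "?E * W = 1\<^sub>m n" and WE: "W * ?E = 1\<^sub>m (dim_row W)"
        using W carrier_matD(1)[OF E] unfolding inverts_mat_def by simp_all
      have "dim_col W = n" using arg_cong[OF EW, of dim_col] by simp
      moreover have "dim_row W = n" using arg_cong[OF WE, of dim_col] carrier_matD(2)[OF E]
        by (simp only: index_mult_mat index_one_mat)
      ultimately have Wc: "W \<in> carrier_mat n n" by auto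
      have WE': "W * ?E = 1\<^sub>m n" using WE carrier_matD(1)[OF Wc] by (simp only:)
      show ?thesis unfolding Units_def
        by (intro CollectI conjI bexI[of _ W]) (simp_all only: ring_mat_simps E Wc EW WE')
    qed
    then show ?thesis using mat_inverse(1)[OF E None, of "()"] by blast
  qed (use that in blast)
  from mat_inverse(2)[OF E V] have VE: "V * ?E = 1\<^sub>m n" and Vc: "V \<in> carrier_mat n n" by auto
  let ?X = "cmat C *\<^sub>v x"
  have y: "?X \<in> carrier_vec p" by (rule C_mult_carrier[OF x])
  define q where "q = cmat A *\<^sub>v x - cmat B *\<^sub>v (cmat KP *\<^sub>v ?X) - cmat B *\<^sub>v (cmat KI *\<^sub>v z)"
  have q: "q \<in> carrier_vec n"
    unfolding q_def by (intro minus_carrier_vec A_mult_carrier B_mult_carrier KP_mult_carrier KI_mult_carrier y x z)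
  have lin: "cmat B *\<^sub>v (- a - b - c) = - (cmat B *\<^sub>v a) - cmat B *\<^sub>v b - cmat B *\<^sub>v c"
    if "a \<in> carrier_vec m" "b \<in> carrier_vec m" "c \<in> carrier_vec m" for a b c
    using B that by (simp add: mult_minus_distrib_mat_vec[of _ n m] mult_mat_uminus_vec[of _ n m]
        minus_carrier_vec)
  have Bd: "cmat B *\<^sub>v (cmat KD *\<^sub>v d) = \<mu> \<cdot>\<^sub>v (cmat B *\<^sub>v (cmat KD *\<^sub>v ?X))"
    unfolding md using B KD y KD_mult_carrier[OF y] by (simp add: mult_mat_vec[of _ m p] mult_mat_vec[of _ n m])
  have "cmat ?E *\<^sub>v x = x + cmat B *\<^sub>v (cmat KD *\<^sub>v ?X)"
  proof -
    have BKC: "B * KD * C \<in> carrier_mat n n" using B KD C by simp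
    have "cmat ?E *\<^sub>v x = x + cmat (B * KD * C) *\<^sub>v x"
      unfolding cmat_add[OF one_carrier_mat BKC] cmat_one
      by (subst add_mult_distrib_mat_vec[of _ n n]) (use BKC x in simp_all)
    then show ?thesis
      unfolding cmat_mult_vec[OF mult_carrier_mat[OF B KD] C x] cmat_mult_vec[OF B KD y] .
  qed
  then have "cmat ?E *\<^sub>v (\<mu> \<cdot>\<^sub>v x) = \<mu> \<cdot>\<^sub>v (x + cmat B *\<^sub>v (cmat KD *\<^sub>v ?X))"
    using mult_mat_vec[of "cmat ?E" n n x] E x by simp
  also have "\<dots> = \<mu> \<cdot>\<^sub>v x + cmat B *\<^sub>v (cmat KD *\<^sub>v d)"
    unfolding Bd using x B_mult_carrier[OF KD_mult_carrier[OF y]] by (simp add: smult_add_distrib_vec[of _ n])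
  also have "\<dots> = q"
  proof -
    have alg: "a + (- b - c - e) + e = a - b - c"
      if "a \<in> carrier_vec n" "b \<in> carrier_vec n" "c \<in> carrier_vec n" "e \<in> carrier_vec n"
      for a b c e :: "complex vec"
      by (rule eq_vecI) (use that in auto)
    show ?thesis
      unfolding mx control_def q_def lin[OF KP_mult_carrier[OF y] KI_mult_carrier[OF z] KD_mult_carrier[OF d]]
      by (rule alg) (intro A_mult_carrier B_mult_carrier KP_mult_carrier KI_mult_carrier KD_mult_carrier x z d y)+
  qed
  finally have Eq: "cmat ?E *\<^sub>v (\<mu> \<cdot>\<^sub>v x) = q" .
  have mxc: "\<mu> \<cdot>\<^sub>v x \<in> carrier_vec n" using x by simp
  have "cmat V *\<^sub>v q = cmat (V * ?E) *\<^sub>v (\<mu> \<cdot>\<^sub>v x)"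
    unfolding Eq[symmetric] by (rule cmat_mult_vec[OF Vc E mxc, symmetric])
  then have Vq: "cmat V *\<^sub>v q = \<mu> \<cdot>\<^sub>v x" unfolding VE using x by (simp add: cmat_one)
  let ?T = "V * (A - B * KP * C)" and ?S = "- (V * B * KI)"
  have T: "?T \<in> carrier_mat n n"
    by (rule mult_carrier_mat[OF Vc minus_carrier_mat[OF mult_carrier_mat[OF mult_carrier_mat[OF B KP] C]]])
  have S: "?S \<in> carrier_mat n p"
    using mult_carrier_mat[OF mult_carrier_mat[OF Vc B] KI] by (simp only: uminus_carrier_iff_mat)
  have ideal: "ideal_pid_matrix A B C KP KI KD = four_block_mat ?T ?S C (0\<^sub>m p p)"
    using A C V by (simp add: ideal_pid_matrix_def Let_def)
  have Ic: "cmat (ideal_pid_matrix A B C KP KI KD) \<in> carrier_mat (n + p) (n + p)"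
    unfolding ideal using T by simp
  have "cmat ?T *\<^sub>v x = cmat V *\<^sub>v (cmat A *\<^sub>v x - cmat B *\<^sub>v (cmat KP *\<^sub>v ?X))"
  proof -
    have BKC: "B * KP * C \<in> carrier_mat n n" using B KP C by simp
    have "cmat (A - B * KP * C) *\<^sub>v x = cmat A *\<^sub>v x - cmat (B * KP * C) *\<^sub>v x"
      unfolding cmat_minus[OF A BKC]
      by (rule minus_mult_distrib_mat_vec[of _ n n]) (use A BKC x in simp_all)
    then show ?thesis
      unfolding cmat_mult_vec[OF Vc minus_carrier_mat[OF BKC] x]
        cmat_mult_vec[OF mult_carrier_mat[OF B KP] C x] cmat_mult_vec[OF B KP y] by simp
  qed
  moreover have "cmat ?S *\<^sub>v z = - (cmat V *\<^sub>v (cmat B *\<^sub>v (cmat KI *\<^sub>v z)))"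
  proof -
    have "cmat ?S *\<^sub>v z = - (cmat (V * B * KI) *\<^sub>v z)"
      unfolding cmat_uminus by (rule uminus_mult_mat_vec) (use KI z in simp)
    then show ?thesis
      using cmat_mult_vec[OF mult_carrier_mat[OF Vc B] KI z] cmat_mult_vec[OF Vc B KI_mult_carrier[OF z]] by simp
  qed
  moreover have "cmat V *\<^sub>v q = cmat V *\<^sub>v (cmat A *\<^sub>v x - cmat B *\<^sub>v (cmat KP *\<^sub>v ?X))
      - cmat V *\<^sub>v (cmat B *\<^sub>v (cmat KI *\<^sub>v z))"
    unfolding q_def
    by (rule mult_minus_distrib_mat_vec[of _ n n]) (use Vc A_mult_carrier[OF x] B_mult_carrier[OF KP_mult_carrier[OF y]] B_mult_carrier[OF KI_mult_carrier[OF z]]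
        in \<open>simp_all add: minus_carrier_vec\<close>)
  moreover have "cmat V *\<^sub>v (cmat A *\<^sub>v x - cmat B *\<^sub>v (cmat KP *\<^sub>v ?X)) \<in> carrier_vec n"
    "cmat V *\<^sub>v (cmat B *\<^sub>v (cmat KI *\<^sub>v z)) \<in> carrier_vec n"
    using Vc by (auto intro!: mult_mat_vec_carrier[of _ n n] minus_carrier_vec A_mult_carrier B_mult_carrier KP_mult_carrier KI_mult_carrier x y z)
  ultimately have top: "cmat ?T *\<^sub>v x + cmat ?S *\<^sub>v z = \<mu> \<cdot>\<^sub>v x"
    using Vq minus_add_uminus_vec[of _ n] by metis
  have "cmat (0\<^sub>m p p) *\<^sub>v z = 0\<^sub>v p" using z by (intro eq_vecI) (auto simp: scalar_prod_def)
  then have bot: "?X + cmat (0\<^sub>m p p) *\<^sub>v z = \<mu> \<cdot>\<^sub>v z" using y mz by simp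
  have "cmat (ideal_pid_matrix A B C KP KI KD) *\<^sub>v (x @\<^sub>v z)
      = (cmat ?T *\<^sub>v x + cmat ?S *\<^sub>v z) @\<^sub>v (?X + cmat (0\<^sub>m p p) *\<^sub>v z)"
    unfolding ideal cmat_four_block[OF T S C zero_carrier_mat]
    by (rule four_block_mat_mult_vec[of _ n n _ p _ p]) (use T S C x z in simp_all)
  also have "\<dots> = \<mu> \<cdot>\<^sub>v (x @\<^sub>v z)" unfolding top bot by (rule eq_vecI) auto
  finally have "cmat (ideal_pid_matrix A B C KP KI KD) *\<^sub>v (x @\<^sub>v z) = \<mu> \<cdot>\<^sub>v (x @\<^sub>v z)" .
  moreover have "x @\<^sub>v z \<noteq> 0\<^sub>v (n + p)"
  proof
    assume "x @\<^sub>v z = 0\<^sub>v (n + p)"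
    also have "0\<^sub>v (n + p) = 0\<^sub>v n @\<^sub>v (0\<^sub>v p :: complex vec)" by (rule eq_vecI) auto
    finally show False using nz append_vec_eq[OF x, of "0\<^sub>v n"] by auto
  qed
  ultimately show ?thesis
    using x z Ic carrier_matD(1)[OF Ic] unfolding eigenvalue_def eigenvector_def
    by (intro exI[of _ "x @\<^sub>v z"]) simp
qed

text \<open>The change of coordinates from $r$ to $d$ is injective for $h > 0$, so an eigenvector stays nonzero
  and can be normalised after it.\<close>

lemma normalized_eigenvector:
  assumes h: "h > 0" and ev: "eigenvalue (cmat (sampled h)) l"
  obtains x z d where "x \<in> carrier_vec n" "z \<in> carrier_vec p" "d \<in> carrier_vec p"
    "norm1_vec x + norm1_vec z + norm1_vec d = 1"
    "cmat (sampled h) *\<^sub>v (x @\<^sub>v (z @\<^sub>v (cmat C *\<^sub>v x - complex_of_real h \<cdot>\<^sub>v d)))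
      = l \<cdot>\<^sub>v (x @\<^sub>v (z @\<^sub>v (cmat C *\<^sub>v x - complex_of_real h \<cdot>\<^sub>v d)))"
proof -
  let ?N = "n + (p + p)" and ?M = "cmat (sampled h)" and ?c = "complex_of_real"
  have M: "?M \<in> carrier_mat ?N ?N" using sampled_carrier by simp
  obtain v where v: "v \<in> carrier_vec ?N" "v \<noteq> 0\<^sub>v ?N" "?M *\<^sub>v v = l \<cdot>\<^sub>v v"
    using ev carrier_matD[OF M] by (auto simp: eigenvalue_def eigenvector_def)
  define x where "x = vec_first v n"
  define z where "z = vec_first (vec_last v (p + p)) p"
  define r where "r = vec_last (vec_last v (p + p)) p"
  define d where "d = ?c (1 / h) \<cdot>\<^sub>v (cmat C *\<^sub>v x - r)"
  have c: "x \<in> carrier_vec n" "z \<in> carrier_vec p" "r \<in> carrier_vec p"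
    by (simp_all add: x_def z_def r_def)
  note y = C_mult_carrier[OF c(1)]
  have d: "d \<in> carrier_vec p" using y c by (simp add: d_def minus_carrier_vec)
  have veq: "v = x @\<^sub>v (z @\<^sub>v r)"
    using v(1) by (simp add: x_def z_def r_def vec_first_last_append[of _ n "p + p"]
        vec_first_last_append[of _ p p])
  have rd: "r = cmat C *\<^sub>v x - ?c h \<cdot>\<^sub>v d"
    unfolding d_def using y c h by (intro eq_vecI) (auto simp del: index_mult_mat_vec)
  define T where "T = norm1_vec x + norm1_vec z + norm1_vec d"
  have "T \<noteq> 0"
  proof
    assume "T = 0"
    then have "norm1_vec x = 0" "norm1_vec z = 0" "norm1_vec d = 0"
      unfolding T_def using norm1_vec_nonneg[of x] norm1_vec_nonneg[of z] norm1_vec_nonneg[of d]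
      by linarith+
    then have 0: "x = 0\<^sub>v n" "z = 0\<^sub>v p" "d = 0\<^sub>v p" using norm1_vec_eq_0 c d by blast+
    have "r = 0\<^sub>v p" unfolding rd unfolding 0 using C by (intro eq_vecI) auto
    then have "v = 0\<^sub>v ?N" unfolding veq 0 by (intro eq_vecI) auto
    with v(2) show False ..
  qed
  moreover have "T \<ge> 0" unfolding T_def by (intro add_nonneg_nonneg norm1_vec_nonneg)
  ultimately have T: "T > 0" by simp
  let ?t = "?c (1 / T)"
  have w: "?t \<cdot>\<^sub>v v = (?t \<cdot>\<^sub>v x) @\<^sub>v ((?t \<cdot>\<^sub>v z) @\<^sub>v (cmat C *\<^sub>v (?t \<cdot>\<^sub>v x) - ?c h \<cdot>\<^sub>v (?t \<cdot>\<^sub>v d)))"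
  proof -
    have "cmat C *\<^sub>v (?t \<cdot>\<^sub>v x) = ?t \<cdot>\<^sub>v (cmat C *\<^sub>v x)"
      by (rule mult_mat_vec[of _ p n]) (use C c in simp_all)
    moreover have "?t \<cdot>\<^sub>v (a - ?c h \<cdot>\<^sub>v b) = ?t \<cdot>\<^sub>v a - ?c h \<cdot>\<^sub>v (?t \<cdot>\<^sub>v b)"
      if "a \<in> carrier_vec p" "b \<in> carrier_vec p" for a b
      by (rule eq_vecI) (use that in \<open>auto simp: algebra_simps\<close>)
    moreover have "?t \<cdot>\<^sub>v v = (?t \<cdot>\<^sub>v x) @\<^sub>v ((?t \<cdot>\<^sub>v z) @\<^sub>v (?t \<cdot>\<^sub>v r))"
      unfolding veq by (rule eq_vecI) auto
    ultimately show ?thesis using y d rd by simp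
  qed
  show thesis
  proof (rule that)
    show "?t \<cdot>\<^sub>v x \<in> carrier_vec n" "?t \<cdot>\<^sub>v z \<in> carrier_vec p" "?t \<cdot>\<^sub>v d \<in> carrier_vec p"
      using c d by simp_all
    show "norm1_vec (?t \<cdot>\<^sub>v x) + norm1_vec (?t \<cdot>\<^sub>v z) + norm1_vec (?t \<cdot>\<^sub>v d) = 1"
    proof -
      have "cmod ?t = 1 / T" using T by (simp add: norm_divide)
      then have "norm1_vec (?t \<cdot>\<^sub>v x) + norm1_vec (?t \<cdot>\<^sub>v z) + norm1_vec (?t \<cdot>\<^sub>v d) = 1 / T * T"
        unfolding norm1_vec_smult by (simp only: T_def distrib_left)
      then show ?thesis using T by simp
    qed
    show "?M *\<^sub>v ((?t \<cdot>\<^sub>v x) @\<^sub>v ((?t \<cdot>\<^sub>v z) @\<^sub>v (cmat C *\<^sub>v (?t \<cdot>\<^sub>v x) - ?c h \<cdot>\<^sub>v (?t \<cdot>\<^sub>v d)))) =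
      l \<cdot>\<^sub>v ((?t \<cdot>\<^sub>v x) @\<^sub>v ((?t \<cdot>\<^sub>v z) @\<^sub>v (cmat C *\<^sub>v (?t \<cdot>\<^sub>v x) - ?c h \<cdot>\<^sub>v (?t \<cdot>\<^sub>v d))))"
      unfolding w[symmetric] mult_mat_vec[OF M v(1)] v(3)
      by (simp add: smult_smult_assoc mult.commute)
  qed
qed

text \<open>The contradiction for a sequence of normalised eigenvectors that already converges.\<close>

lemma no_limit_outside_unit_disk:
  assumes inv: "invertible_mat (1\<^sub>m n + B * KD * C)"
    and hur: "hurwitz (ideal_pid_matrix A B C KP KI KD)"
    and fast: "\<And>\<mu>. eigenvalue (cmat (C * B * KD)) \<mu> \<Longrightarrow> cmod \<mu> < 1"
    and h: "\<And>k. h k > 0" "h \<longlonglongrightarrow> 0"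
    and l: "\<And>k. 1 \<le> cmod (l k)" and \<kappa>: "(\<lambda>k. 1 / l k) \<longlonglongrightarrow> \<kappa>0"
    and x: "tends_vec n x x0" and z: "tends_vec p z z0" and d: "tends_vec p d d0"
    and norm: "\<And>k. norm1_vec (x k) + norm1_vec (z k) + norm1_vec (d k) = 1"
    and ev: "\<And>k. cmat (sampled (h k)) *\<^sub>v (x k @\<^sub>v (z k @\<^sub>v (cmat C *\<^sub>v x k - complex_of_real (h k) \<cdot>\<^sub>v d k)))
      = l k \<cdot>\<^sub>v (x k @\<^sub>v (z k @\<^sub>v (cmat C *\<^sub>v x k - complex_of_real (h k) \<cdot>\<^sub>v d k)))"
  shows False
proof -
  let ?c = complex_of_real
  define \<mu> where "\<mu> k = (l k - 1) / ?c (h k)" for k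
  have l0: "l k \<noteq> 0" for k using l[of k] by auto
  have ch: "(\<lambda>k. ?c (h k)) \<longlonglongrightarrow> 0" using tendsto_of_real[OF h(2), where 'a = complex] by simp
  note eqs = eigenvector_equations[OF tends_vecD(1)[OF x] tends_vecD(1)[OF z] tends_vecD(1)[OF d]
      h(1) l0 ev, folded \<mu>_def]
  define F where "F k = rate (h k) (x k) (z k) (d k)" for k
  define F0 where "F0 = cmat A *\<^sub>v x0 + cmat B *\<^sub>v control x0 z0 d0"
  note eqs = eqs[folded F_def]
  have F: "tends_vec n F F0" unfolding F_def[abs_def] F0_def by (rule tends_rate[OF h x z d])
  note x0 = tends_vecD(2)[OF x] and z0 = tends_vecD(2)[OF z] and d0 = tends_vecD(2)[OF d]
  have d0eq: "d0 = \<kappa>0 \<cdot>\<^sub>v (cmat C *\<^sub>v F0)"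
  proof (rule tends_vec_unique[OF d])
    show "tends_vec p d (\<kappa>0 \<cdot>\<^sub>v (cmat C *\<^sub>v F0))"
      using tends_vec_smult[OF \<kappa> tends_plant(2)[OF F]] by (simp only: eqs(5)[symmetric])
  qed
  show False
  proof (cases "x0 = 0\<^sub>v n \<and> z0 = 0\<^sub>v p")
    case True
    have "(\<lambda>k. norm1_vec (x k) + norm1_vec (z k) + norm1_vec (d k)) \<longlonglongrightarrow>
        norm1_vec x0 + norm1_vec z0 + norm1_vec d0"
      by (intro tendsto_add tendsto_norm1_vec[OF x] tendsto_norm1_vec[OF z] tendsto_norm1_vec[OF d])
    then have "norm1_vec x0 + norm1_vec z0 + norm1_vec d0 = 1"
      unfolding norm by (simp add: LIMSEQ_const_iff)
    then have dn: "d0 \<noteq> 0\<^sub>v p" using True by (auto simp: norm1_vec_def)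
    \<comment> \<open>The slow part vanishes, so the fast equation $d = \kappa\, C F$ becomes $d = -\kappa M_D d$.\<close>
    have "F0 = - (cmat B *\<^sub>v (cmat KD *\<^sub>v d0))"
    proof -
      have "control x0 z0 d0 = - (cmat KD *\<^sub>v d0)"
        using True KP KI KD C d0 by (intro eq_vecI) (auto simp: control_def scalar_prod_def)
      moreover have "cmat B *\<^sub>v - (cmat KD *\<^sub>v d0) = - (cmat B *\<^sub>v (cmat KD *\<^sub>v d0))"
        by (rule mult_mat_uminus_vec[of _ n m]) (use B KD_mult_carrier[OF d0] in simp_all)
      moreover have "cmat A *\<^sub>v x0 = 0\<^sub>v n"
        using True A by (intro eq_vecI) (auto simp: scalar_prod_def)
      ultimately show ?thesis unfolding F0_def using B_mult_carrier[OF KD_mult_carrier[OF d0]] by simp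
    qed
    moreover have "cmat C *\<^sub>v - (cmat B *\<^sub>v (cmat KD *\<^sub>v d0)) = - (cmat C *\<^sub>v (cmat B *\<^sub>v (cmat KD *\<^sub>v d0)))"
      by (rule mult_mat_uminus_vec[of _ p n]) (use C B_mult_carrier[OF KD_mult_carrier[OF d0]] in simp_all)
    moreover have "cmat (C * B * KD) *\<^sub>v d0 = cmat C *\<^sub>v (cmat B *\<^sub>v (cmat KD *\<^sub>v d0))"
      unfolding cmat_mult_vec[OF mult_carrier_mat[OF C B] KD d0] cmat_mult_vec[OF C B KD_mult_carrier[OF d0]] ..
    ultimately have d0M: "d0 = \<kappa>0 \<cdot>\<^sub>v - (cmat (C * B * KD) *\<^sub>v d0)" using d0eq by simp
    have Mc: "cmat (C * B * KD) \<in> carrier_mat p p" using C B KD by simp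
    have Md: "cmat (C * B * KD) *\<^sub>v d0 \<in> carrier_vec p" by (rule mult_mat_vec_carrier[OF Mc d0])
    have k0: "\<kappa>0 \<noteq> 0"
    proof
      assume "\<kappa>0 = 0"
      then have "d0 = 0\<^sub>v p" using d0M Md by (metis smult_0_vec uminus_carrier_vec)
      then show False using dn by simp
    qed
    have "(- 1 / \<kappa>0) \<cdot>\<^sub>v d0 = (- 1 / \<kappa>0) \<cdot>\<^sub>v (\<kappa>0 \<cdot>\<^sub>v - (cmat (C * B * KD) *\<^sub>v d0))"
      using d0M by simp
    also have "\<dots> = cmat (C * B * KD) *\<^sub>v d0"
      using Md k0 by (intro eq_vecI) (auto simp del: index_mult_mat_vec)
    finally have "eigenvalue (cmat (C * B * KD)) (- 1 / \<kappa>0)"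
      using d0 dn carrier_matD(1)[OF Mc] unfolding eigenvalue_def eigenvector_def
      by (intro exI[of _ d0]) simp
    then have "cmod (- 1 / \<kappa>0) < 1" by (rule fast)
    then have "1 < cmod \<kappa>0" using k0 by (simp add: norm_divide)
    moreover have "cmod \<kappa>0 \<le> 1"
    proof (rule LIMSEQ_le_const2[OF tendsto_norm[OF \<kappa>]])
      show "\<exists>N. \<forall>k\<ge>N. cmod (1 / l k) \<le> 1" using l l0 by (auto simp: norm_divide divide_le_eq)
    qed
    ultimately show False by simp
  next
    case False
    \<comment> \<open>The slow part changes only by terms of order $h$ in one step, which forces $\lambda \to 1$.\<close>
    have k1: "\<kappa>0 = 1"
    proof -
      have "x0 = \<kappa>0 \<cdot>\<^sub>v x0"
      proof (rule tends_vec_unique[OF x])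
        have "tends_vec n x (\<kappa>0 \<cdot>\<^sub>v (x0 + 0 \<cdot>\<^sub>v F0))"
          using tends_vec_smult[OF \<kappa> tends_vec_add[OF x tends_vec_smult[OF ch F]]]
          by (simp only: eqs(1)[symmetric])
        moreover have "x0 + 0 \<cdot>\<^sub>v F0 = x0" using x0 tends_vecD(2)[OF F] by (intro eq_vecI) auto
        ultimately show "tends_vec n x (\<kappa>0 \<cdot>\<^sub>v x0)" by simp
      qed
      moreover have "z0 = \<kappa>0 \<cdot>\<^sub>v z0"
      proof (rule tends_vec_unique[OF z])
        have "tends_vec p z (\<kappa>0 \<cdot>\<^sub>v (z0 + 0 \<cdot>\<^sub>v (cmat C *\<^sub>v x0)))"
          using tends_vec_smult[OF \<kappa> tends_vec_add[OF z tends_vec_smult[OF ch tends_plant(2)[OF x]]]]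
          by (simp only: eqs(2)[symmetric])
        moreover have "z0 + 0 \<cdot>\<^sub>v (cmat C *\<^sub>v x0) = z0" using z0 by (simp add: smult_0_vec[OF C_mult_carrier[OF x0]])
        ultimately show "tends_vec p z (\<kappa>0 \<cdot>\<^sub>v z0)" by simp
      qed
      moreover have "\<kappa>0 = 1" if v: "v = \<kappa>0 \<cdot>\<^sub>v v" "v \<in> carrier_vec N" "v \<noteq> 0\<^sub>v N" for v N
      proof -
        obtain i where i: "i < N" "v $ i \<noteq> 0"
          using v(2,3) by (metis carrier_vecD eq_vecI index_zero_vec)
        have "v $ i = (\<kappa>0 \<cdot>\<^sub>v v) $ i" using v(1) by simp
        then show ?thesis using i v(2) by simp
      qed
      ultimately show ?thesis using False x0 z0 by blast
    qed
    obtain \<mu>0 where m: "\<mu> \<longlonglongrightarrow> \<mu>0"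
      using False quotient_converges[OF x F eqs(3)]
        quotient_converges[OF z tends_plant(2)[OF x] eqs(4)] by blast
    have "tends_vec n F (\<mu>0 \<cdot>\<^sub>v x0)" using tends_vec_smult[OF m x] by (simp add: eqs(3))
    then have mx: "\<mu>0 \<cdot>\<^sub>v x0 = F0" using tends_vec_unique[OF _ F] by blast
    have "tends_vec p (\<lambda>k. cmat C *\<^sub>v x k) (\<mu>0 \<cdot>\<^sub>v z0)"
      using tends_vec_smult[OF m z] by (simp add: eqs(4))
    then have mz: "\<mu>0 \<cdot>\<^sub>v z0 = cmat C *\<^sub>v x0" using tends_vec_unique[OF _ tends_plant(2)[OF x]] by blast
    have md: "d0 = \<mu>0 \<cdot>\<^sub>v (cmat C *\<^sub>v x0)"
    proof -
      have "cmat C *\<^sub>v (\<mu>0 \<cdot>\<^sub>v x0) = \<mu>0 \<cdot>\<^sub>v (cmat C *\<^sub>v x0)"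
        by (rule mult_mat_vec[of _ p n]) (use C x0 in simp_all)
      then show ?thesis using d0eq by (simp add: k1 mx[symmetric])
    qed
    have "eigenvalue (cmat (ideal_pid_matrix A B C KP KI KD)) \<mu>0"
      by (rule ideal_eigenvalue[OF inv x0 z0 d0 _ mx[unfolded F0_def] mz md]) (use False in blast)
    then have "Re \<mu>0 < 0" using hur by (simp add: hurwitz_def)
    moreover have "0 \<le> Re \<mu>0"
    proof (rule Re_nonneg_of_outside[OF h m])
      fix k
      have "1 + ?c (h k) * \<mu> k = l k" using h(1)[of k] by (simp add: \<mu>_def)
      then show "1 \<le> cmod (1 + ?c (h k) * \<mu> k)" using l by simp
    qed
    ultimately show False by simp
  qed
qed

text \<open>Compactness supplies the convergent subsequence: all entries of the normalised vectors and the
  numbers $1/l_k$ are bounded by $1$.\<close>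

lemma sampled_eigenvalues_in_disk:
  assumes inv: "invertible_mat (1\<^sub>m n + B * KD * C)"
    and hur: "hurwitz (ideal_pid_matrix A B C KP KI KD)"
    and fast: "\<And>\<mu>. eigenvalue (cmat (C * B * KD)) \<mu> \<Longrightarrow> cmod \<mu> < 1"
    and h: "\<And>k. h k > 0" "h \<longlonglongrightarrow> 0"
    and ev: "\<And>k. eigenvalue (cmat (sampled (h k))) (l k)"
  shows "\<exists>k. cmod (l k) < 1"
proof (rule ccontr)
  assume "\<nexists>k. cmod (l k) < 1"
  then have l: "1 \<le> cmod (l k)" for k by (simp add: not_less)
  then have l0: "l k \<noteq> 0" for k by (metis norm_zero not_one_le_zero)
  have "\<exists>x z d. x \<in> carrier_vec n \<and> z \<in> carrier_vec p \<and> d \<in> carrier_vec p \<and>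
    norm1_vec x + norm1_vec z + norm1_vec d = 1 \<and>
    cmat (sampled (h k)) *\<^sub>v (x @\<^sub>v (z @\<^sub>v (cmat C *\<^sub>v x - complex_of_real (h k) \<cdot>\<^sub>v d)))
      = l k \<cdot>\<^sub>v (x @\<^sub>v (z @\<^sub>v (cmat C *\<^sub>v x - complex_of_real (h k) \<cdot>\<^sub>v d)))" for k
    by (rule normalized_eigenvector[OF h(1) ev]) blast
  then obtain x z d where xzd: "\<And>k. x k \<in> carrier_vec n" "\<And>k. z k \<in> carrier_vec p"
    "\<And>k. d k \<in> carrier_vec p" "\<And>k. norm1_vec (x k) + norm1_vec (z k) + norm1_vec (d k) = 1"
    and eq: "\<And>k. cmat (sampled (h k)) *\<^sub>v (x k @\<^sub>v (z k @\<^sub>v (cmat C *\<^sub>v x k - complex_of_real (h k) \<cdot>\<^sub>v d k)))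
      = l k \<cdot>\<^sub>v (x k @\<^sub>v (z k @\<^sub>v (cmat C *\<^sub>v x k - complex_of_real (h k) \<cdot>\<^sub>v d k)))"
    by metis
  have le: "norm1_vec (x k) \<le> 1" "norm1_vec (z k) \<le> 1" "norm1_vec (d k) \<le> 1" for k
    using xzd(4)[of k] norm1_vec_nonneg[of "x k"] norm1_vec_nonneg[of "z k"] norm1_vec_nonneg[of "d k"]
    by linarith+
  have entry: "cmod (v $ i) \<le> 1" if "v \<in> carrier_vec N" "i < N" "norm1_vec v \<le> 1" for v N i
    using entry_le_norm1_vec[of i v] that by simp
  obtain s1 x0 where s1: "strict_mono s1" "tends_vec n (\<lambda>k. x (s1 k)) x0"
    using bounded_vec_convergent_subseq[of x n 1] xzd(1) entry[OF xzd(1) _ le(1)] by blast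
  obtain s2 z0 where s2: "strict_mono s2" "tends_vec p (\<lambda>k. z (s1 (s2 k))) z0"
    using bounded_vec_convergent_subseq[of "\<lambda>k. z (s1 k)" p 1] xzd(2) entry[OF xzd(2) _ le(2)]
    by blast
  obtain s3 d0 where s3: "strict_mono s3" "tends_vec p (\<lambda>k. d (s1 (s2 (s3 k)))) d0"
    using bounded_vec_convergent_subseq[of "\<lambda>k. d (s1 (s2 k))" p 1] xzd(3) entry[OF xzd(3) _ le(3)]
    by blast
  have "cmod (1 / l k) \<le> 1" for k using l[of k] l0[of k] by (simp add: norm_divide divide_le_eq)
  then obtain s4 \<kappa>0 where s4: "strict_mono s4" "(\<lambda>k. 1 / l (s1 (s2 (s3 (s4 k))))) \<longlonglongrightarrow> \<kappa>0"
    using finite_family_convergent_subseq[of "{()}" "\<lambda>_ k. 1 / l (s1 (s2 (s3 k)))" 1] by auto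
  define s where "s k = s1 (s2 (s3 (s4 k)))" for k
  have s34: "strict_mono (\<lambda>k. s3 (s4 k))" using strict_mono_o[OF s3(1) s4(1)] by (simp add: o_def)
  have s24: "strict_mono (\<lambda>k. s2 (s3 (s4 k)))" using strict_mono_o[OF s2(1) s34] by (simp add: o_def)
  have s: "strict_mono s" using strict_mono_o[OF s1(1) s24] by (simp add: o_def s_def[abs_def])
  show False
  proof (rule no_limit_outside_unit_disk[OF inv hur fast])
    show "\<And>k. h (s k) > 0" by (rule h)
    show "(\<lambda>k. h (s k)) \<longlonglongrightarrow> 0" using LIMSEQ_subseq_LIMSEQ[OF h(2) s] by (simp add: o_def)
    show "\<And>k. 1 \<le> cmod (l (s k))" by (rule l)
    show "(\<lambda>k. 1 / l (s k)) \<longlonglongrightarrow> \<kappa>0" using s4(2) by (simp add: s_def)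
    show "tends_vec n (\<lambda>k. x (s k)) x0" using tends_vec_subseq[OF s1(2) s24] by (simp add: s_def)
    show "tends_vec p (\<lambda>k. z (s k)) z0" using tends_vec_subseq[OF s2(2) s34] by (simp add: s_def)
    show "tends_vec p (\<lambda>k. d (s k)) d0" using tends_vec_subseq[OF s3(2) s4(1)] by (simp add: s_def)
  qed (assumption | rule xzd(4) eq)+
qed

end

section \<open>Small sampling periods\<close>

theorem corollary2:
  fixes n m p :: nat and A B C KP KI KD :: "real mat"
  assumes "n > 0" and "m > 0" and "p > 0"
    and "A \<in> carrier_mat n n" and "B \<in> carrier_mat n m" and "C \<in> carrier_mat p n"
    and "KP \<in> carrier_mat m p" and "KI \<in> carrier_mat m p" and "KD \<in> carrier_mat m p"
    and "invertible_mat (1\<^sub>m n + B * KD * C)"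
    and "hurwitz (ideal_pid_matrix A B C KP KI KD)"
    and "\<forall>\<mu> :: complex. cmod \<mu> = 1 \<longrightarrow> \<not> eigenvalue (cmat (C * B * KD)) \<mu>"
  shows "((\<exists>hs > 0. \<forall>h. 0 < h \<and> h < hs \<longrightarrow> sampled_pid_stable A B C KP KI KD h)
            \<longleftrightarrow> spectral_radius (cmat (C * B * KD)) < 1)
       \<and> (spectral_radius (cmat (C * B * KD)) > 1 \<longrightarrow>
            (\<exists>h0 > 0. \<forall>h. 0 < h \<and> h < h0 \<longrightarrow> \<not> sampled_pid_stable A B C KP KI KD h))"
proof -
  interpret pid_plant n m p A B C KP KI KD by unfold_locales (use assms in simp_all)
  let ?M = "cmat (C * B * KD)"
  have M: "?M \<in> carrier_mat p p" using assms by simp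
  note sr = spectral_radius_less_iff[OF M \<open>p > 0\<close>]
  have unstable: "\<exists>h0>0. \<forall>h. 0 < h \<and> h < h0 \<longrightarrow> \<not> sampled_pid_stable A B C KP KI KD h"
    if gt: "spectral_radius ?M > 1"
  proof (rule ccontr)
    assume "\<not> ?thesis"
    then obtain h where h: "\<And>k. h k > 0" "h \<longlonglongrightarrow> 0"
      "\<And>k. sampled_pid_stable A B C KP KI KD (h k)" by (rule vanishing_sequence) blast
    obtain \<mu> where "eigenvalue ?M \<mu>" "cmod \<mu> = spectral_radius ?M"
      using spectral_radius_mem_max(1)[OF M \<open>p > 0\<close>] by (auto simp: spectrum_def)
    then show False
      using fast_eigenvalues_bounded[OF h(1,2)] h(3) gt by (force simp: sampled_pid_stable_def)
  qed
  have ne1: "spectral_radius ?M \<noteq> 1"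
    using spectral_radius_mem_max(1)[OF M \<open>p > 0\<close>] assms(12) by (auto simp: spectrum_def)
  have stable: "\<exists>hs>0. \<forall>h. 0 < h \<and> h < hs \<longrightarrow> sampled_pid_stable A B C KP KI KD h"
    if lt: "spectral_radius ?M < 1"
  proof (rule ccontr)
    assume "\<not> ?thesis"
    then have "\<not> (\<exists>hs>0. \<forall>h. 0 < h \<and> h < hs \<longrightarrow> \<not> \<not> sampled_pid_stable A B C KP KI KD h)" by simp
    then obtain h where h: "\<And>k. h k > 0" "h \<longlonglongrightarrow> 0"
      "\<And>k. \<not> sampled_pid_stable A B C KP KI KD (h k)" by (rule vanishing_sequence) blast
    have "\<exists>l. eigenvalue (cmat (sampled (h k))) l \<and> \<not> cmod l < 1" for k
      using exponentially_stable_if_eigenvalues[OF sampled_carrier] \<open>n > 0\<close> h(3)[of k]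
      by (auto simp: sampled_pid_stable_def)
    then obtain l where l: "\<And>k. eigenvalue (cmat (sampled (h k))) (l k)" "\<And>k. \<not> cmod (l k) < 1"
      by metis
    show False
      using sampled_eigenvalues_in_disk[OF assms(10,11) _ h(1,2) l(1)] sr lt l(2) by blast
  qed
  have "spectral_radius ?M < 1"
    if ex: "\<exists>hs>0. \<forall>h. 0 < h \<and> h < hs \<longrightarrow> sampled_pid_stable A B C KP KI KD h"
  proof (rule ccontr)
    assume "\<not> ?thesis"
    then have "spectral_radius ?M > 1" using ne1 by simp
    from unstable[OF this] ex obtain hs h0 where
      hs: "hs > 0" "\<And>h. 0 < h \<Longrightarrow> h < hs \<Longrightarrow> sampled_pid_stable A B C KP KI KD h" and
      h0: "h0 > 0" "\<And>h. 0 < h \<Longrightarrow> h < h0 \<Longrightarrow> \<not> sampled_pid_stable A B C KP KI KD h" by blast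
    have "0 < min hs h0 / 2" "min hs h0 / 2 < hs" "min hs h0 / 2 < h0"
      using hs(1) h0(1) by (auto simp: min_def)
    then show False using hs(2) h0(2) by blast
  qed
  with stable unstable show ?thesis by blast
qed

end
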